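(* Let $k\geq0$ be an integer, let $\mathcal{H}$ be a class of weighted graphs, and let $\mathcal{G}$ be a class of weighted graphs each of which is $(k,\mathcal{H})$-constructable. Then $\mathrm{ANdim}(\mathcal{G})\leq\max(\mathrm{ANdim}(\mathcal{H}),1)$.
   Context: All graphs are finite. A weighted graph is a graph $G$ with a weighting $w:E(G)\to\mathbb{R}^+\cup\{\infty\}$; the length of a path is the sum of its edge weights and $\mathrm{dist}_G(u,v)$ is the least length of a $u$–$v$ path ($\infty$ if none). Subgraphs inherit weights but distances in a subgraph are computed in the subgraph. $\mathrm{wdiam}_G(S)=\max_{u,v\in S}\mathrm{dist}_G(u,v)$. For $r>0$ an $r$-path is a sequence of vertices with consecutive vertices at distance at most $r$ in $G$. A map $c:V(G)\to C$, $|C|=m$, is an $(m,r,d)$-colouring if every $r$-path in $G$ whose vertices all receive the same colour has weak diameter in $G$ at most $d$. $f:\mathbb{R}^+\to\mathbb{R}^+$ is an $n$-dimensional control function for $G$ (for a class: for every member) if $G$ admits an $(n+1,r,f(r))$-colouring for every $r>0$. $f$ is a dilation if $f(r)\leq cr$ for some $c>0$ and all $r>0$. $\mathrm{ANdim}$ of a class is the least $n\geq0$ for which the class has an $n$-dimensional control function that is a dilation ($\infty$ if none). A tree-decomposition $(B_t:t\in V(T))$ of $G$ ($T$ a tree, $B_t\subseteq V(G)$) satisfies: for each $v$ the set of $t$ with $v\in B_t$ induces a nonempty subtree, and each edge has both ends in some bag. Its adhesion is $\max_{tt'\in E(T)}|B_t\cap B_{t'}|$. The torso at $t$ is $G[B_t]$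 plus an edge $uv$ for every pair $u,v\in B_t\cap B_{t'}$ with $t'$ adjacent to $t$ (if not already present). The weighted torso at $t$ is the torso with each edge $uv$ given weight $\mathrm{dist}_G(u,v)$ (distance in the whole of $G$). A $(k,\mathcal{H})$-construction of $G$ is a tree-decomposition of $G$ of adhesion at most $k$ all of whose weighted torsos lie in $\mathcal{H}$; $G$ is $(k,\mathcal{H})$-constructable if it has one. *)

theory Defs
  imports
    "HOL-Library.FuncSet"
    "HOL-Library.Extended_Nat"
    "HOL-Library.Extended_Nonnegative_Real"
begin

section \<open>Finite simple graphs and trees\<close>

record 'a ugraph =
  verts :: "'a set"
  edges :: "'a set set"

definition graph :: "('a, 'b) ugraph_scheme \<Rightarrow> bool" where
  "graph G \<longleftrightarrow> finite (verts G) \<and> (\<forall>e\<in>edges G. e \<subseteq> verts G \<and> card e = 2)"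

definition path :: "('a, 'b) ugraph_scheme \<Rightarrow> 'a \<Rightarrow> 'a list \<Rightarrow> 'a \<Rightarrow> bool" where
  "path G u p v \<longleftrightarrow> p \<noteq> [] \<and> hd p = u \<and> last p = v \<and> distinct p \<and> set p \<subseteq> verts G \<and>
     successively (\<lambda>x y. {x, y} \<in> edges G) p"

definition cycle :: "('a, 'b) ugraph_scheme \<Rightarrow> 'a list \<Rightarrow> bool" where
  "cycle G p \<longleftrightarrow> 3 \<le> length p \<and> path G (hd p) p (last p) \<and> {last p, hd p} \<in> edges G"

definition is_tree :: "('a, 'b) ugraph_scheme \<Rightarrow> bool" where
  "is_tree T \<longleftrightarrow> graph T \<and> verts T \<noteq> {} \<and>
     (\<forall>u\<in>verts T. \<forall>v\<in>verts T. \<exists>p. path T u p v) \<and> (\<nexists>p. cycle T p)"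

definition induced :: "('a, 'b) ugraph_scheme \<Rightarrow> 'a set \<Rightarrow> 'a ugraph" where
  "induced G S = \<lparr>verts = verts G \<inter> S, edges = {e \<in> edges G. e \<subseteq> S}\<rparr>"

section \<open>Weighted graphs and distances\<close>

record 'a wgraph = "'a ugraph" +
  weight :: "'a set \<Rightarrow> ennreal"

text \<open>
  Weights are positive and may be infinite. The weighting is extensional (\<^const>\<open>undefined\<close> off
  the edge set), so that two weighted graphs with the same vertices, edges and edge weights are
  equal, and membership in a class of weighted graphs does not depend on junk values.
\<close>

definition weighted_graph :: "'a wgraph \<Rightarrow> bool" where
  "weighted_graph G \<longleftrightarrow> graph G \<and> weight G \<in> edges G \<rightarrow>\<^sub>E {0<..}"

definition path_length :: "'a wgraph \<Rightarrow> 'a list \<Rightarrow> ennreal" where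
  "path_length G p = (\<Sum>e\<leftarrow>map2 (\<lambda>x y. {x, y}) p (tl p). weight G e)"

text \<open>A finite graph has only finitely many paths, so this infimum is attained unless there is no
  path at all, in which case it is \<open>\<infinity>\<close>.\<close>

definition gdist :: "'a wgraph \<Rightarrow> 'a \<Rightarrow> 'a \<Rightarrow> ennreal" where
  "gdist G u v = (INF p\<in>{p. path G u p v}. path_length G p)"

definition wdiam :: "'a wgraph \<Rightarrow> 'a set \<Rightarrow> ennreal" where
  "wdiam G S = (SUP u\<in>S. SUP v\<in>S. gdist G u v)"

section \<open>Assouad--Nagata dimension\<close>

definition r_path :: "'a wgraph \<Rightarrow> real \<Rightarrow> 'a list \<Rightarrow> bool" where
  "r_path G r p \<longleftrightarrow> p \<noteq> [] \<and> set p \<subseteq> verts G \<and> successively (\<lambda>x y. gdist G x y \<le> ennreal r) p"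

definition colouring :: "nat \<Rightarrow> real \<Rightarrow> real \<Rightarrow> 'a wgraph \<Rightarrow> ('a \<Rightarrow> nat) \<Rightarrow> bool" where
  "colouring m r d G c \<longleftrightarrow> c \<in> verts G \<rightarrow> {..<m} \<and>
     (\<forall>p. r_path G r p \<and> (\<forall>x\<in>set p. \<forall>y\<in>set p. c x = c y) \<longrightarrow> wdiam G (set p) \<le> ennreal d)"

text \<open>Control functions map positive reals to positive reals; their values at nonpositive
  arguments are irrelevant.\<close>

definition control_function :: "nat \<Rightarrow> (real \<Rightarrow> real) \<Rightarrow> 'a wgraph set \<Rightarrow> bool" where
  "control_function n f \<C> \<longleftrightarrow> (\<forall>r>0. f r > 0) \<and>
     (\<forall>G\<in>\<C>. \<forall>r>0. \<exists>c. colouring (n + 1) r (f r) G c)"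

definition dilation :: "(real \<Rightarrow> real) \<Rightarrow> bool" where
  "dilation f \<longleftrightarrow> (\<exists>c>0. \<forall>r>0. f r \<le> c * r)"

text \<open>In \<^typ>\<open>enat\<close> the infimum of a nonempty set is its least element and that of the empty
  set is \<open>\<infinity>\<close>.\<close>

definition ANdim :: "'a wgraph set \<Rightarrow> enat" where
  "ANdim \<C> = (INF n\<in>{n. \<exists>f. control_function n f \<C> \<and> dilation f}. enat n)"

section \<open>Tree-decompositions and constructions\<close>

definition tree_decomposition ::
    "('a, 'b) ugraph_scheme \<Rightarrow> ('t, 'c) ugraph_scheme \<Rightarrow> ('t \<Rightarrow> 'a set) \<Rightarrow> bool" where
  "tree_decomposition G T B \<longleftrightarrow> is_tree T \<and>
     (\<forall>t\<in>verts T. B t \<subseteq> verts G) \<and>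
     (\<forall>v\<in>verts G. is_tree (induced T {t \<in> verts T. v \<in> B t})) \<and>
     (\<forall>e\<in>edges G. \<exists>t\<in>verts T. e \<subseteq> B t)"

text \<open>Inserting 0 makes the adhesion 0 when the tree has no edge.\<close>

definition adhesion :: "('t, 'c) ugraph_scheme \<Rightarrow> ('t \<Rightarrow> 'a set) \<Rightarrow> nat" where
  "adhesion T B = Max (insert 0 {card (B t \<inter> B t') | t t'. {t, t'} \<in> edges T})"

definition torso ::
    "('a, 'b) ugraph_scheme \<Rightarrow> ('t, 'c) ugraph_scheme \<Rightarrow> ('t \<Rightarrow> 'a set) \<Rightarrow> 't \<Rightarrow> 'a ugraph" where
  "torso G T B t = \<lparr>
     verts = B t,
     edges = edges (induced G (B t)) \<union>
       {{u, v} | u v. u \<noteq> v \<and> (\<exists>t'. {t, t'} \<in> edges T \<and> u \<in> B t \<inter> B t' \<and> v \<in> B t \<inter> B t')}\<rparr>"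

definition weighted_torso ::
    "'a wgraph \<Rightarrow> ('t, 'c) ugraph_scheme \<Rightarrow> ('t \<Rightarrow> 'a set) \<Rightarrow> 't \<Rightarrow> 'a wgraph" where
  "weighted_torso G T B t = \<lparr>
     verts = verts (torso G T B t),
     edges = edges (torso G T B t),
     weight = (\<lambda>e\<in>edges (torso G T B t). THE d. \<exists>u v. e = {u, v} \<and> d = gdist G u v)\<rparr>"

text \<open>The definite description above is well defined because distances are symmetric.\<close>

lemma path_rev: "path G v (rev p) u" if "path G u p v"
  using that by (auto simp: path_def hd_rev last_rev insert_commute)

lemma path_length_rev: "path_length G (rev p) = path_length G p"
proof -
  have snoc: "map2 (\<lambda>x y. {x, y}) (q @ [a]) (tl (q @ [a])) =
      map2 (\<lambda>x y. {x, y}) q (tl q) @ (if q = [] then [] else [{last q, a}])" for q and a :: 'a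
    by (induction q rule: induct_list012) auto
  show ?thesis
  proof (induction p rule: induct_list012)
    case (3 x y zs)
    have "path_length G (rev (x # y # zs)) = path_length G (rev (y # zs)) + weight G {y, x}"
      unfolding path_length_def rev.simps(2)[of x] snoc by (simp add: last_rev)
    also have "\<dots> = path_length G (x # y # zs)"
      using 3 by (simp add: path_length_def insert_commute add.commute)
    finally show ?case .
  qed (auto simp: path_length_def)
qed

lemma gdist_commute: "gdist G u v = gdist G v u"
proof -
  have "gdist G u v \<le> gdist G v u" for u v
    unfolding gdist_def
    by (rule INF_greatest) (metis INF_lower mem_Collect_eq path_rev path_length_rev)
  then show ?thesis by (simp add: order_antisym)
qed

lemma weight_weighted_torso:
  assumes "{u, v} \<in> edges (torso G T B t)"
  shows "weight (weighted_torso G T B t) {u, v} = gdist G u v"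
proof -
  have "(THE d. \<exists>x y. {u, v} = {x, y} \<and> d = gdist G x y) = gdist G u v"
    by (rule the_equality) (auto simp: doubleton_eq_iff gdist_commute)
  with assms show ?thesis by (simp add: weighted_torso_def)
qed

text \<open>Every finite tree is isomorphic to one with nodes in \<^typ>\<open>nat\<close>, so this choice of node type
  loses no generality.\<close>

definition construction ::
    "nat \<Rightarrow> 'a wgraph set \<Rightarrow> 'a wgraph \<Rightarrow> nat ugraph \<Rightarrow> (nat \<Rightarrow> 'a set) \<Rightarrow> bool" where
  "construction k \<H> G T B \<longleftrightarrow> tree_decomposition G T B \<and> adhesion T B \<le> k \<and>
     (\<forall>t\<in>verts T. weighted_torso G T B t \<in> \<H>)"

definition constructable :: "nat \<Rightarrow> 'a wgraph set \<Rightarrow> 'a wgraph \<Rightarrow> bool" where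
  "constructable k \<H> G \<longleftrightarrow> (\<exists>T B. construction k \<H> G T B)"

end

theory Submission
  imports Defs
begin

text \<open>
  Work with the metric of \<open>G\<close> throughout: it agrees on every bag with the metric of the weighted
  torso, and each adhesion set separates its two sides metrically. The colouring is built by
  induction on the adhesion, with linear control at each step.

  Fix \<open>r\<close> and a subtree whose upper adhesion set \<open>S\<close> is already coloured. The points at distance
  at most \<open>r\<close> from \<open>S\<close> copy the colour of a nearby point of \<open>S\<close>; those at distance in \<open>(r, 2r]\<close>
  get colour 1 and those in \<open>(2r, 3r]\<close> get colour 0, so that no monochromatic \<open>r\<close>-path passes from
  the outside of this ball \<open>N\<close> to \<open>S\<close>; this is why at least two colours are needed. Let \<open>W\<close> be the union
  of the bags reached from the top through adhesion sets meeting \<open>N\<close>. Deleting \<open>N\<close> lowers these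
  adhesions, so by induction \<open>W - N\<close> has a colouring at scale \<open>R = (5k\<^sup>2 + 4) r\<close> for the metric of paths
  avoiding \<open>N\<close>. Jumps that this metric misses occur close to the at most \<open>k\<close> points of \<open>S\<close>, so the
  colouring stays bounded at scale \<open>R\<close> on \<open>W\<close> for the original metric. The remaining pieces hang
  off \<open>W\<close> at adhesion sets disjoint from \<open>N\<close> and are coloured afresh in the same way. A
  monochromatic \<open>r\<close>-path then stays within one such \<open>W\<close> and the collars of the pieces hanging off it.
\<close>

section \<open>Closeness predicates and monochromatic chains\<close>

text \<open>\<open>D p x y\<close> stands for ``the distance of \<open>x\<close> and \<open>y\<close> is at most \<open>p\<close>''; this avoids infinite
  values and infima altogether. Below, \<open>D\<close> measures the jumps of a chain, while a second, coarser
  predicate \<open>dl\<close> measures diameters.\<close>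

locale closeness =
  fixes D :: "real \<Rightarrow> 'a \<Rightarrow> 'a \<Rightarrow> bool"
  assumes nonneg: "D p x y \<Longrightarrow> 0 \<le> p"
    and refl0: "D 0 x x"
    and sym: "D p x y \<Longrightarrow> D p y x"
    and mono: "D p x y \<Longrightarrow> p \<le> q \<Longrightarrow> D q x y"
    and tri: "D p x y \<Longrightarrow> D q y z \<Longrightarrow> D (p + q) x z"
begin

lemma refl: "0 \<le> p \<Longrightarrow> D p x x"
  using refl0 mono by blast

lemma tri_le: "D p x y \<Longrightarrow> D q y z \<Longrightarrow> p + q \<le> t \<Longrightarrow> D t x z"
  using tri mono by blast

text \<open>In a finite relation, reachability needs at most as many steps as the relation has
  pairs, and a relation on \<open>S\<close> has at most \<open>k * k\<close> of them. The bound is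
  therefore independent of the length of the given walk.\<close>

lemma hops_bound:
  assumes S: "finite S" "card S \<le> k" and L: "0 \<le> L"
    and st: "(\<lambda>s s'. s \<in> S \<and> s' \<in> S \<and> D L s s')\<^sup>*\<^sup>* s t"
  shows "D (L * real (k * k)) s t"
proof -
  define R where "R = {(s, s'). s \<in> S \<and> s' \<in> S \<and> D L s s'}"
  have sub: "R \<subseteq> S \<times> S" by (auto simp: R_def)
  have fin: "finite R" using finite_subset[OF sub] S by auto
  have "card R \<le> card (S \<times> S)" using sub S by (intro card_mono) auto
  also have "\<dots> \<le> k * k" using S by (simp add: card_cartesian_product mult_le_mono)
  finally have cR: "card R \<le> k * k" .
  have pow: "(s, t) \<in> R ^^ n \<Longrightarrow> D (L * real n) s t" for n t
  proof (induction n arbitrary: t)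
    case 0 then show ?case by (simp add: refl0)
  next
    case (Suc n)
    then obtain u where "(s, u) \<in> R ^^ n" "(u, t) \<in> R" by auto
    then have "D (L * real n) s u" "D L u t" using Suc by (auto simp: R_def)
    from tri[OF this] show ?case by (simp add: algebra_simps)
  qed
  have "(s, t) \<in> R\<^sup>*"
    using st by (simp add: R_def rtranclp_rtrancl_eq[symmetric])
  then obtain n where n: "n \<le> card R" "(s, t) \<in> R ^^ n"
    using rtrancl_finite_eq_relpow[OF fin] by auto
  have "L * real n \<le> L * real (k * k)"
    using n cR L by (intro mult_left_mono) (simp_all only: of_nat_le_iff)
  then show ?thesis using pow[OF n(2)] mono by blast
qed

end

section \<open>Separation and monochromatic chains\<close>

definition near :: "(real \<Rightarrow> 'a \<Rightarrow> 'a \<Rightarrow> bool) \<Rightarrow> 'a set \<Rightarrow> real \<Rightarrow> 'a \<Rightarrow> bool" where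
  "near D S p x \<longleftrightarrow> (\<exists>s\<in>S. D p x s)"

definition between :: "(real \<Rightarrow> 'a \<Rightarrow> 'a \<Rightarrow> bool) \<Rightarrow> 'a set \<Rightarrow> real \<Rightarrow> 'a \<Rightarrow> 'a \<Rightarrow> bool" where
  "between D S p x y \<longleftrightarrow> (\<exists>z\<in>S. \<exists>a b. D a x z \<and> D b z y \<and> a + b \<le> p)"

definition separates :: "(real \<Rightarrow> 'a \<Rightarrow> 'a \<Rightarrow> bool) \<Rightarrow> 'a set \<Rightarrow> 'a set \<Rightarrow> 'a set \<Rightarrow> bool" where
  "separates D S X Y \<longleftrightarrow> (\<forall>x\<in>X. \<forall>y\<in>Y. \<forall>p. D p x y \<longrightarrow> between D S p x y)"

definition chain :: "(real \<Rightarrow> 'a \<Rightarrow> 'a \<Rightarrow> bool) \<Rightarrow> 'a set \<Rightarrow> ('a \<Rightarrow> nat) \<Rightarrow> real \<Rightarrow> 'a \<Rightarrow> 'a \<Rightarrow> bool" where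
  "chain D X c r = (\<lambda>u v. u \<in> X \<and> v \<in> X \<and> c u = c v \<and> D r u v)\<^sup>*\<^sup>*"

lemma chain_refl: "chain D X c r x x"
  by (simp add: chain_def)

lemma chain_step:
  "chain D X c r x u \<Longrightarrow> u \<in> X \<Longrightarrow> v \<in> X \<Longrightarrow> c u = c v \<Longrightarrow> D r u v \<Longrightarrow> chain D X c r x v"
  unfolding chain_def by (rule rtranclp.rtrancl_into_rtrancl) auto

lemma chain_induct [consumes 1, case_names refl step]:
  assumes "chain D X c r x y"
    and "P x"
    and "\<And>u v. chain D X c r x u \<Longrightarrow> u \<in> X \<Longrightarrow> v \<in> X \<Longrightarrow> c u = c v \<Longrightarrow> D r u v \<Longrightarrow> P u \<Longrightarrow> P v"
  shows "P y"
  using assms(1) unfolding chain_def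
  by (induction rule: rtranclp_induct) (use assms(2,3) in \<open>auto simp: chain_def\<close>)

lemma chain_trans: "chain D X c r x y \<Longrightarrow> chain D X c r y z \<Longrightarrow> chain D X c r x z"
  unfolding chain_def by auto

lemma (in closeness) chain_sym: "chain D X c r x y \<Longrightarrow> chain D X c r y x"
proof (induction rule: chain_induct)
  case refl then show ?case by (rule chain_refl)
next
  case (step u v)
  have "chain D X c r v u"
    by (rule chain_step[OF chain_refl]) (use step sym in auto)
  then show ?case using step chain_trans by metis
qed

lemma chain_colour: "chain D X c r x y \<Longrightarrow> c x = c y"
  by (induction rule: chain_induct) auto

lemma chain_mem: "chain D X c r x y \<Longrightarrow> x = y \<or> x \<in> X \<and> y \<in> X"
  by (induction rule: chain_induct) auto

lemma chain_mono:
  assumes "chain D X c r x y"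
    and "\<And>u v. u \<in> X \<Longrightarrow> v \<in> X \<Longrightarrow> c u = c v \<Longrightarrow> D r u v \<Longrightarrow> u \<in> Y \<and> v \<in> Y \<and> c' u = c' v \<and> D' r' u v"
  shows "chain D' Y c' r' x y"
  using assms(1)
proof (induction rule: chain_induct)
  case refl then show ?case by (rule chain_refl)
next
  case (step u v)
  then show ?case using assms(2)[of u v] chain_step by metis
qed

section \<open>Bounds for chains in a region and across the pieces hanging off it\<close>

locale two_closeness = closeness D + outer: closeness dl
  for D dl :: "real \<Rightarrow> 'a \<Rightarrow> 'a \<Rightarrow> bool" +
  assumes sub: "D p x y \<Longrightarrow> dl p x y"
begin

text \<open>Every point of the chain stays within \<open>E\<close> of \<open>S\<close>: it lies in
  the \<open>\<rho>\<close>-ball, or a \<open>D'\<close>-chain joins it to a point within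
  \<open>\<rho> + R\<close> of \<open>S\<close>. Replacing the points by such nearby points of
  \<open>S\<close> turns the chain into hops of length \<open>2 * E + R\<close> on at most
  \<open>k\<close> points, to which \<open>hops_bound\<close> applies.\<close>

lemma region_bound_near:
  fixes K \<rho> R :: real and k :: nat
  defines "E \<equiv> \<rho> + R + K"
  assumes S: "finite S" "card S \<le> k" and pos: "0 \<le> \<rho>" "0 \<le> R" "0 \<le> K"
    and short: "\<And>u w. u \<in> W \<Longrightarrow> w \<in> W \<Longrightarrow> \<not> near D S \<rho> u \<Longrightarrow> \<not> near D S \<rho> w \<Longrightarrow> D R u w \<Longrightarrow>
        D' R u w \<or> (\<exists>z. near D S \<rho> z \<and> D R u z \<and> D R w z)"
    and bound: "\<And>u v. chain D' (W - {x. near D S \<rho> x}) c R u v \<Longrightarrow> dl K u v"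
    and q: "near D S (\<rho> + R) q" and ch: "chain D W c R q v"
  shows "dl (2 * E + (2 * E + R) * real (k * k)) q v"
proof -
  let ?N = "{x. near D S \<rho> x}"
  let ?M = "\<lambda>v. near D S \<rho> v \<or> (\<exists>q'. near D S (\<rho> + R) q' \<and> chain D' (W - ?N) c R q' v)"
  let ?hop = "(\<lambda>s s'. s \<in> S \<and> s' \<in> S \<and> dl (2 * E + R) s s')\<^sup>*\<^sup>*"
  have M_E: "\<exists>s\<in>S. dl E v s" if "?M v" for v
    using that
  proof
    assume "near D S \<rho> v"
    then obtain s where s: "s \<in> S" "D \<rho> v s" by (auto simp: near_def)
    have "dl E v s" using outer.mono[OF sub[OF s(2)], of E] pos by (simp add: E_def)
    with s(1) show ?thesis by auto
  next
    assume "\<exists>q'. near D S (\<rho> + R) q' \<and> chain D' (W - ?N) c R q' v"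
    then obtain q' s where "s \<in> S" "D (\<rho> + R) q' s" "dl K q' v"
      using bound by (auto simp: near_def)
    then have "dl E v s" using outer.tri_le[of K v q' "\<rho> + R" s E] sub outer.sym by (auto simp: E_def)
    with \<open>s \<in> S\<close> show ?thesis by auto
  qed
  have Mq: "?M q" using q chain_refl by metis
  then obtain s0 where s0: "s0 \<in> S" "dl E q s0" using M_E by blast
  have E0: "0 \<le> E" using pos by (simp add: E_def)
  from ch have "?M v \<and> (\<exists>s\<in>S. dl E v s \<and> ?hop s0 s)"
  proof (induction rule: chain_induct)
    case refl
    then show ?case using Mq s0 by blast
  next
    case (step u v)
    \<comment> \<open>If the jump starts in the ball or comes within \<open>R\<close> of it, a new
      \<open>D'\<close>-chain starts at \<open>v\<close>; otherwise the current one is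
      continued.\<close>
    have Mv: "?M v"
    proof (cases "near D S \<rho> v")
      case nv: False
      show ?thesis
      proof (cases "near D S \<rho> u")
        case True
        then obtain s where "s \<in> S" "D \<rho> u s" by (auto simp: near_def)
        then have "near D S (\<rho> + R) v"
          using tri_le[of R v u \<rho> s "\<rho> + R"] sym step by (auto simp: near_def)
        then show ?thesis using chain_refl by metis
      next
        case nu: False
        from short[OF step(2,3) nu nv step(5)] show ?thesis
        proof
          assume d: "D' R u v"
          from step nu obtain q' where q': "near D S (\<rho> + R) q'" "chain D' (W - ?N) c R q' u" by auto
          have "chain D' (W - ?N) c R q' v"
            by (rule chain_step[OF q'(2)]) (use step nu nv d in auto)
          with q' show ?thesis by auto
        next
          assume "\<exists>z. near D S \<rho> z \<and> D R u z \<and> D R v z"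
          then obtain z s where "D R v z" "s \<in> S" "D \<rho> z s" by (auto simp: near_def)
          then have "near D S (\<rho> + R) v" using tri_le[of R v z \<rho> s "\<rho> + R"] by (auto simp: near_def)
          then show ?thesis using chain_refl by metis
        qed
      qed
    qed auto
    then obtain s' where s': "s' \<in> S" "dl E v s'" using M_E by blast
    from step obtain s where s: "s \<in> S" "dl E u s" "?hop s0 s" by blast
    have "dl (E + R) s v" using outer.tri[OF outer.sym[OF s(2)] sub[OF step(5)]] .
    then have "dl (2 * E + R) s s'" using outer.tri_le[OF _ s'(2)] by simp
    then have "?hop s0 s'" using s s' by (auto intro: rtranclp.rtrancl_into_rtrancl)
    with Mv s' show ?case by blast
  qed
  then obtain s where s: "s \<in> S" "dl E v s" "?hop s0 s" by blast
  have h: "dl ((2 * E + R) * real (k * k)) s0 s"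
    using outer.hops_bound[OF S _ s(3)] E0 pos by auto
  have "dl (E + (2 * E + R) * real (k * k)) q s" using outer.tri[OF s0(2) h] .
  from outer.tri_le[OF this outer.sym[OF s(2)]] show ?thesis by simp
qed

text \<open>Either the whole chain is a \<open>D'\<close>-chain off the ball and \<open>K\<close>
  bounds it, or it passes through some \<open>q\<close> within \<open>\<rho> + R\<close> of
  \<open>S\<close>. In the second case \<open>region_bound_near\<close> bounds both halves starting
  from \<open>q\<close>, whence the outer factor 2.\<close>

lemma region_bound:
  fixes K \<rho> R :: real and k :: nat
  defines "E \<equiv> \<rho> + R + K"
  assumes S: "finite S" "card S \<le> k" and pos: "0 \<le> \<rho>" "0 \<le> R" "0 \<le> K"
    and short: "\<And>u w. u \<in> W \<Longrightarrow> w \<in> W \<Longrightarrow> \<not> near D S \<rho> u \<Longrightarrow> \<not> near D S \<rho> w \<Longrightarrow> D R u w \<Longrightarrow>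
        D' R u w \<or> (\<exists>z. near D S \<rho> z \<and> D R u z \<and> D R w z)"
    and bound: "\<And>u v. chain D' (W - {x. near D S \<rho> x}) c R u v \<Longrightarrow> dl K u v"
    and ch: "chain D W c R u v"
  shows "dl (2 * (2 * E + (2 * E + R) * real (k * k))) u v"
proof -
  let ?N = "{x. near D S \<rho> x}"
  let ?F = "2 * E + (2 * E + R) * real (k * k)"
  have E0: "K \<le> E" "0 \<le> E" using pos by (auto simp: E_def)
  have "0 \<le> (2 * E + R) * real (k * k)" using E0 pos by (intro mult_nonneg_nonneg) auto
  then have KF: "K \<le> 2 * ?F" 
  proof -
    have "K \<le> 2 * (2 * E + P)" if "0 \<le> P" for P :: real
      using that E0 by (simp add: field_simps)
    then show ?thesis using \<open>0 \<le> (2 * E + R) * real (k * k)\<close> .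
  qed
  have nearb: "dl ?F q w" if "near D S (\<rho> + R) q" "chain D W c R q w" for q w
    using region_bound_near[where D' = D' and W = W and c = c and q = q and v = w,
        OF S pos short bound that] unfolding E_def by simp
  from ch have "chain D' (W - ?N) c R u v \<or>
      (\<exists>q. near D S (\<rho> + R) q \<and> chain D W c R u q \<and> chain D W c R q v)"
  proof (induction rule: chain_induct)
    case refl then show ?case using chain_refl by metis
  next
    case (step w v)
    show ?case
    proof (cases "near D S (\<rho> + R) w")
      case True
      moreover have "chain D W c R w v" by (rule chain_step[OF chain_refl]) (use step in auto)
      ultimately show ?thesis using step by blast
    next
      case far: False
      show ?thesis
      proof (cases "\<exists>q. near D S (\<rho> + R) q \<and> chain D W c R u q \<and> chain D W c R q w")
        case True
        then show ?thesis using chain_step[of D W c R _ w v] step by metis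
      next
        case False
        \<comment> \<open>A jump from \<open>w\<close> that comes within \<open>R\<close> of the
          ball, or ends in it, would place \<open>w\<close> within \<open>\<rho> + R\<close> of
          \<open>S\<close>.\<close>
        have nn: False if "near D S \<rho> z" "D R w z" for z
        proof -
          obtain s where "s \<in> S" "D \<rho> z s" using \<open>near D S \<rho> z\<close> by (auto simp: near_def)
          then have "near D S (\<rho> + R) w" using tri_le[OF \<open>D R w z\<close>, of \<rho> s "\<rho> + R"] by (auto simp: near_def)
          with far show False by simp
        qed
        have nw: "\<not> near D S \<rho> w" using nn[of w] refl pos by auto
        have nv: "\<not> near D S \<rho> v" using nn[of v] step by auto
        have "D' R w v" using short[OF step(2,3) nw nv step(5)] nn by auto
        moreover have "chain D' (W - ?N) c R u w" using step False by auto
        ultimately have "chain D' (W - ?N) c R u v"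
          using chain_step[of D' "W - ?N" c R u w v] step nw nv by auto
        then show ?thesis by simp
      qed
    qed
  qed
  then show ?thesis
  proof
    assume "chain D' (W - ?N) c R u v"
    then show ?thesis using bound outer.mono KF by blast
  next
    assume "\<exists>q. near D S (\<rho> + R) q \<and> chain D W c R u q \<and> chain D W c R q v"
    then obtain q where q: "near D S (\<rho> + R) q" "chain D W c R u q" "chain D W c R q v" by blast
    have "dl ?F q u" "dl ?F q v" using nearb q chain_sym by auto
    then show ?thesis using outer.tri_le[of ?F u q ?F v] outer.sym by auto
  qed
qed

text \<open>A chain in a region \<open>W\<close> and in thin collars of the pieces hanging off it is shadowed by a chain
  in \<open>W\<close> of the same colour with larger jumps: as long as the chain stays in one piece it can only
  wander along the at most \<open>k\<close> attaching vertices, and it enters and leaves a piece through the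
  \<open>r\<close>-collar, where the colour is that of a nearby attaching vertex.\<close>

lemma glue_bound:
  fixes r F :: real and k :: nat
  defines "R \<equiv> (5 * real (k * k) + 4) * r"
  assumes r: "0 \<le> r" and F: "0 \<le> F"
    and fin: "\<And>V' S'. (V', S') \<in> C \<Longrightarrow> finite S' \<and> card S' \<le> k \<and> V' \<inter> W = S'"
    and sep: "\<And>V' S'. (V', S') \<in> C \<Longrightarrow> separates D S' V' (V - V')"
    and V: "V = W \<union> \<Union>(fst ` C)"
    and disj: "\<And>h h'. h \<in> C \<Longrightarrow> h' \<in> C \<Longrightarrow> h \<noteq> h' \<Longrightarrow> fst h \<inter> fst h' \<subseteq> W"
    and zone: "\<And>V' S' v. (V', S') \<in> C \<Longrightarrow> v \<in> V' \<Longrightarrow> near D S' r v \<Longrightarrow> \<exists>s\<in>S'. D r v s \<and> c s = c v"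
    and Wb: "\<And>u v. chain D W c R u v \<Longrightarrow> dl F u v"
    and Z: "\<And>v. v \<in> Z \<Longrightarrow> v \<in> W \<or> (\<exists>V' S'. (V', S') \<in> C \<and> v \<in> V' \<and> near D S' (2 * r) v)"
    and xZ: "x \<in> Z"
    and ch: "chain D Z c r x y"
  shows "dl (2 * r + (R + F) + (5 * r * real (k * k) + 2 * r)) x y"
proof -
  \<comment> \<open>The length \<open>5 * r\<close> is \<open>2 * r\<close> from an attaching vertex
    to the chain, one jump \<open>r\<close>, and \<open>2 * r\<close> back to an attaching
    vertex.\<close>
  let ?hop = "\<lambda>S'. (\<lambda>s s'. s \<in> S' \<and> s' \<in> S' \<and> D (5 * r) s s')\<^sup>*\<^sup>*"
  let ?k = "5 * r * real (k * k)"
  \<comment> \<open>Jumps of the shadow in \<open>W\<close>. Only the target is required to have the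
    colour of the chain, because the first shadow point may have another colour.\<close>
  define G where "G = (\<lambda>u w. w \<in> W \<and> c w = c x \<and> D R u w)"
  \<comment> \<open>Invariant: \<open>w\<close> is the current shadow of \<open>v\<close>. If
    \<open>v\<close> is outside \<open>W\<close>, then \<open>w\<close> is an attaching vertex of
    the piece containing \<open>v\<close>, and hops within the adhesion set lead from
    \<open>w\<close> to a vertex near \<open>v\<close>.\<close>
  define I where "I w0 v \<longleftrightarrow> (\<exists>w\<in>W. G\<^sup>*\<^sup>* w0 w \<and> (v = w \<or> (\<exists>V' S' s. (V', S') \<in> C \<and> w \<in> S' \<and>
      v \<in> V' \<and> v \<notin> W \<and> s \<in> S' \<and> D (2 * r) v s \<and> ?hop S' w s)))" for w0 v
  have k0: "0 \<le> ?k" using r by simp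
  \<comment> \<open>The shadow is within \<open>?k + 2 * r\<close> of the chain; the next jump costs
    \<open>r\<close>, and reaching a new attaching vertex of the right colour costs another
    \<open>r\<close>.\<close>
  have R_eq: "R = ?k + 4 * r" by (simp add: R_def algebra_simps)
  have hop: "D ?k s s'" if "(V', S') \<in> C" "?hop S' s s'" for V' S' s s'
    using hops_bound[of S' k "5 * r"] fin[OF that(1)] that(2) r by auto
  have VW: "z \<in> V' \<and> z \<in> W" if "(V', S') \<in> C" "z \<in> S'" for V' S' z
    using fin that by blast
  have base: "\<exists>w0. dl (2 * r) x w0 \<and> I w0 x"
  proof (cases "x \<in> W")
    case True
    then have "I x x" unfolding I_def by blast
    then show ?thesis using outer.refl[of "2 * r" x] r by auto
  next
    case False
    then obtain V' S' s where h: "(V', S') \<in> C" "x \<in> V'" "s \<in> S'" "D (2 * r) x s"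
      using Z[OF xZ] by (auto simp: near_def)
    then have "I s x" unfolding I_def using False VW[OF h(1,3)] by blast
    then show ?thesis using h sub by blast
  qed
  then obtain w0 where w0: "dl (2 * r) x w0" "I w0 x" by blast
  have newW: "I w0 w'" if "G\<^sup>*\<^sup>* w0 w" "w' \<in> W" "c w' = c x" "D R w w'" for w w'
    unfolding I_def using that by (auto simp: G_def intro!: bexI[of _ w'] intro: rtranclp.rtrancl_into_rtrancl)
  have newV: "I w0 v" if "G\<^sup>*\<^sup>* w0 w" "w' \<in> S'" "c w' = c x" "D R w w'" "(V', S') \<in> C"
      "v \<in> V'" "v \<notin> W" "D (2 * r) v w'" for w w' v V' S'
  proof -
    have "w' \<in> W" using VW that by blast
    moreover have "G\<^sup>*\<^sup>* w0 w'" using that(1,3,4) \<open>w' \<in> W\<close>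
      by (auto simp: G_def intro: rtranclp.rtrancl_into_rtrancl)
    ultimately show ?thesis unfolding I_def using that by blast
  qed
  from ch have "I w0 y"
  proof (induction rule: chain_induct)
    case refl show ?case by (rule w0)
  next
    case (step v v')
    have cx: "c v = c x" "c v' = c x" using step chain_colour[OF step(1)] by auto
    from \<open>I w0 v\<close> obtain w where w: "w \<in> W" "G\<^sup>*\<^sup>* w0 w" and
      alt: "v = w \<or> (\<exists>V' S' s. (V', S') \<in> C \<and> w \<in> S' \<and>
        v \<in> V' \<and> v \<notin> W \<and> s \<in> S' \<and> D (2 * r) v s \<and> ?hop S' w s)"
      unfolding I_def by blast
    have vV: "v \<in> V" using Z[OF step(2)] V by force
        have Dvw: "D (?k + 2 * r) v w"
      using alt
    proof
      assume "v = w" then show ?thesis using refl k0 r by auto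
    next
      assume "\<exists>V' S' s. (V', S') \<in> C \<and> w \<in> S' \<and>
        v \<in> V' \<and> v \<notin> W \<and> s \<in> S' \<and> D (2 * r) v s \<and> ?hop S' w s"
      then obtain V' S' s where "(V', S') \<in> C" "D (2 * r) v s" "?hop S' w s" by blast
      then show ?thesis using tri_le[of "2 * r" v s ?k w] hop sym by auto
    qed
    show ?case
    proof (cases "v' \<in> W")
      case True
      have "D R w v'" using tri_le[OF sym[OF Dvw] step(5), of R] R_eq r by auto
      then show ?thesis using newW w True cx by blast
    next
      case v'W: False
      then obtain V' S' s' where h': "(V', S') \<in> C" "v' \<in> V'" "s' \<in> S'" "D (2 * r) v' s'"
        using Z[OF step(3)] by (auto simp: near_def)
      show ?thesis
      proof (cases "v \<in> V'")
        case False
        \<comment> \<open>The chain enters a piece from outside, so \<open>v'\<close> is within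
          \<open>r\<close> of the adhesion set and \<open>zone\<close> provides an attaching vertex
          of the same colour as the new shadow.\<close>
        have "separates D S' (V') (V - V')" by (rule sep[OF h'(1)])
        then have "between D S' r v' v"
          using sym[OF step(5)] h' vV False unfolding separates_def by blast
        then obtain z a b where z: "z \<in> S'" "D a v' z" "D b z v" "a + b \<le> r" by (auto simp: between_def)
        have "D r v' z" using z mono[OF z(2), of r] nonneg[OF z(3)] by auto
        then have "near D S' r v'" using z by (auto simp: near_def)
        then obtain s where s: "s \<in> S'" "D r v' s" "c s = c v'" using zone[OF h'(1,2)] by blast
        have "D (r + r) v s" using tri[OF step(5) s(2)] .
        then have "D R w s" using tri_le[OF sym[OF Dvw], of "r + r" s R] R_eq by auto
        moreover have "D (2 * r) v' s" using mono[OF s(2)] r by auto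
        ultimately show ?thesis using newV[OF w(2) s(1) _ _ h'(1,2) v'W] s cx by auto
      next
        case vV': True
        \<comment> \<open>The chain stays in one piece: the shadow \<open>w\<close> is kept and the
          walk of hops gets one hop longer.\<close>
        show ?thesis using alt
        proof
          assume vw: "v = w"
          then have "w \<in> S'" using vV' w fin[OF h'(1)] by blast
          moreover have "D (5 * r) w s'" using tri_le[OF step(5) h'(4), of "5 * r"] vw r by auto
          ultimately have "?hop S' w s'" using h' by auto
          then show ?thesis unfolding I_def using w \<open>w \<in> S'\<close> h' v'W by blast
        next
          assume "\<exists>V' S' s. (V', S') \<in> C \<and> w \<in> S' \<and>
            v \<in> V' \<and> v \<notin> W \<and> s \<in> S' \<and> D (2 * r) v s \<and> ?hop S' w s"
          then obtain V'' S'' s where h: "(V'', S'') \<in> C" "w \<in> S''"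
            "v \<in> V''" "v \<notin> W" "s \<in> S''" "D (2 * r) v s" "?hop S'' w s" by blast
          have "(V'', S'') = (V', S')" using disj[OF h(1) h'(1)] h(3,4) vV' by auto
          then have h2: "w \<in> S'" "s \<in> S'" "?hop S' w s" using h by auto
          have "D (2 * r + r) s v'" using tri[OF sym[OF h(6)] step(5)] .
          then have "D (5 * r) s s'" using tri_le[OF _ h'(4)] by auto
          then have "?hop S' w s'" using h2 h' by (auto intro: rtranclp.rtrancl_into_rtrancl)
          then show ?thesis unfolding I_def using w h2 h' v'W by blast
        qed
      qed
    qed
  qed
  then obtain w where w: "w \<in> W" "G\<^sup>*\<^sup>* w0 w" and
    alt: "y = w \<or> (\<exists>V' S' s. (V', S') \<in> C \<and> w \<in> S' \<and>
      y \<in> V' \<and> y \<notin> W \<and> s \<in> S' \<and> D (2 * r) y s \<and> ?hop S' w s)"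
    unfolding I_def by blast
  have wy: "D (?k + 2 * r) w y"
    using alt
  proof
    assume "y = w" then show ?thesis using refl k0 r by auto
  next
    assume "\<exists>V' S' s. (V', S') \<in> C \<and> w \<in> S' \<and>
      y \<in> V' \<and> y \<notin> W \<and> s \<in> S' \<and> D (2 * r) y s \<and> ?hop S' w s"
    then obtain V' S' s where "(V', S') \<in> C" "D (2 * r) y s" "?hop S' w s" by blast
    then show ?thesis using tri_le[of ?k w s "2 * r" y] hop sym by auto
  qed
  \<comment> \<open>Since \<open>w0\<close> may have the wrong colour, its first jump is split off
    and paid for by \<open>R\<close>; the rest is a monochromatic chain in \<open>W\<close>, paid
    for by \<open>F\<close>.\<close>
  have G: "w = w0 \<or> (\<exists>w1\<in>W. c w1 = c x \<and> D R w0 w1 \<and> chain D W c R w1 w \<and> w \<in> W \<and> c w = c x)"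
    using w(2)
  proof (induction rule: rtranclp_induct)
    case base then show ?case by simp
  next
    case (step u v)
    from step(2) have v: "v \<in> W" "c v = c x" "D R u v" by (auto simp: G_def)
    from step(3) show ?case
    proof
      assume "u = w0" then show ?thesis using v chain_refl by metis
    next
      assume "\<exists>w1\<in>W. c w1 = c x \<and> D R w0 w1 \<and> chain D W c R w1 u \<and> u \<in> W \<and> c u = c x"
      then show ?thesis using v chain_step[of D W c R _ u v] by metis
    qed
  qed
  have R0: "0 \<le> R" using R_eq r k0 by auto
  have "dl (R + F) w0 w" using G
  proof
    assume "w = w0" then show ?thesis using outer.refl R0 F by auto
  next
    assume "\<exists>w1\<in>W. c w1 = c x \<and> D R w0 w1 \<and> chain D W c R w1 w \<and> w \<in> W \<and> c w = c x"
    then show ?thesis using outer.tri sub Wb by blast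
  qed
  from outer.tri[OF outer.tri[OF w0(1) this] sub[OF wy]] show ?thesis .
qed

end

section \<open>Colouring tree-decomposed sets\<close>

text \<open>\<open>td D Pc A V B\<close>: the set \<open>V\<close> has a rooted tree-decomposition with root bag \<open>B\<close>, all bags
  satisfying \<open>Pc\<close> and all adhesion sets satisfying \<open>A\<close>; a child is given by its union of bags
  and its root bag.\<close>

inductive td :: "(real \<Rightarrow> 'a \<Rightarrow> 'a \<Rightarrow> bool) \<Rightarrow> ('a set \<Rightarrow> bool) \<Rightarrow> ('a set \<Rightarrow> bool) \<Rightarrow> 'a set \<Rightarrow> 'a set \<Rightarrow> bool"
  for D Pc A where
  node: "Pc B \<Longrightarrow> V = B \<union> \<Union>(fst ` C) \<Longrightarrow> (\<And>V' B'. (V', B') \<in> C \<Longrightarrow> td D Pc A V' B') \<Longrightarrow>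
    (\<And>V' B'. (V', B') \<in> C \<Longrightarrow> A (B \<inter> B') \<and> V' \<inter> B \<subseteq> B' \<and> separates D (B \<inter> B') V' (V - V')) \<Longrightarrow>
    (\<And>h h'. h \<in> C \<Longrightarrow> h' \<in> C \<Longrightarrow> h \<noteq> h' \<Longrightarrow> fst h \<inter> fst h' \<subseteq> B) \<Longrightarrow> td D Pc A V B"

lemma td_bag_subset: "td D Pc A V B \<Longrightarrow> B \<subseteq> V"
  by (induction rule: td.induct) auto

lemma separates_mono: "separates D S X Y \<Longrightarrow> S \<subseteq> S' \<Longrightarrow> Y' \<subseteq> Y \<Longrightarrow> separates D S' X Y'"
  unfolding separates_def between_def by (meson subsetD)

context closeness
begin

text \<open>A connection from \<open>V'\<close> to a point outside \<open>V\<close> passes some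
  \<open>z\<close> in \<open>B\<close>. Either \<open>z\<close> lies in \<open>V'\<close>, hence in
  \<open>S\<close>, or the part from \<open>V'\<close> to \<open>z\<close> is already cut by
  \<open>S\<close> inside \<open>V\<close>.\<close>

lemma separates_extend:
  assumes out: "separates D B V (U - V)" and loc: "separates D S V' (V - V')"
    and sub: "V' \<subseteq> V" "V' \<inter> B \<subseteq> S" "B \<subseteq> V"
  shows "separates D S V' (U - V')"
  unfolding separates_def
proof (intro ballI allI impI)
  fix x y p assume x: "x \<in> V'" and y: "y \<in> U - V'" and D: "D p x y"
  show "between D S p x y"
  proof (cases "y \<in> V")
    case True then show ?thesis using loc x y D unfolding separates_def by blast
  next
    case False
    then obtain z a b where z: "z \<in> B" "D a x z" "D b z y" "a + b \<le> p"
      using out x y D sub unfolding separates_def between_def by blast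
    show ?thesis
    proof (cases "z \<in> V'")
      case True then show ?thesis using z sub unfolding between_def by blast
    next
      case False
      then have "between D S a x z" using loc x z sub unfolding separates_def by blast
      then obtain z' a' b' where z': "z' \<in> S" "D a' x z'" "D b' z' z" "a' + b' \<le> a"
        unfolding between_def by blast
      have "D (b' + b) z' y" using tri[OF z'(3) z(3)] .
      moreover have "a' + (b' + b) \<le> p" using z z' by linarith
      ultimately show ?thesis using z' unfolding between_def by blast
    qed
  qed
qed

end

text \<open>The path metric on \<open>U - N\<close> generated by the pairs between which no point of \<open>N\<close> lies; it plays
  the role of the intrinsic metric of the graph with \<open>N\<close> deleted.\<close>

inductive avoid :: "(real \<Rightarrow> 'a \<Rightarrow> 'a \<Rightarrow> bool) \<Rightarrow> 'a set \<Rightarrow> 'a set \<Rightarrow> real \<Rightarrow> 'a \<Rightarrow> 'a \<Rightarrow> bool"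
  for D U N where
  edge: "x \<in> U - N \<Longrightarrow> y \<in> U - N \<Longrightarrow> D p x y \<Longrightarrow> \<not> between D N p x y \<Longrightarrow> avoid D U N p x y"
| refl: "0 \<le> p \<Longrightarrow> avoid D U N p x x"
| trans: "avoid D U N p x y \<Longrightarrow> avoid D U N q y z \<Longrightarrow> p + q \<le> t \<Longrightarrow> avoid D U N t x z"

context closeness
begin

lemma avoid_imp: "avoid D U N p x y \<Longrightarrow> D p x y"
  by (induction rule: avoid.induct) (auto intro: refl tri_le)

lemma between_sym: "between D N p x y \<Longrightarrow> between D N p y x"
  unfolding between_def by (metis add.commute sym)

lemma closeness_avoid: "closeness (avoid D U N)"
proof
  fix p q x y z
  show "0 \<le> p" if "avoid D U N p x y" using avoid_imp[OF that] nonneg by blast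
  show "avoid D U N 0 x x" by (rule avoid.refl) simp
  show "avoid D U N p y x" if "avoid D U N p x y"
    using that
  proof (induction rule: avoid.induct)
    case (edge x y p)
    then show ?case using sym between_sym avoid.edge by metis
  next
    case (trans p x y q z t)
    then show ?case using avoid.trans[of D U N q z y p x t] by simp
  qed (rule avoid.refl)
  show "avoid D U N q x y" if "avoid D U N p x y" "p \<le> q"
    by (rule avoid.trans[OF that(1) avoid.refl[of "q - p"]]) (use that in auto)
  show "avoid D U N (p + q) x z" if "avoid D U N p x y" "avoid D U N q y z"
    by (rule avoid.trans[OF that]) simp
qed

text \<open>This is the hypothesis \<open>short\<close> of \<open>region_bound\<close> for the
  metric that avoids \<open>N\<close>.\<close>

lemma avoid_short:
  assumes "u \<in> U - N" "w \<in> U - N" "D R u w"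
  shows "avoid D U N R u w \<or> (\<exists>z\<in>N. D R u z \<and> D R w z)"
proof (cases "between D N R u w")
  case True
  then obtain z a b where z: "z \<in> N" "D a u z" "D b z w" "a + b \<le> R" unfolding between_def by blast
  have "D R u z" by (rule mono[OF z(2)]) (use z nonneg[OF z(3)] in auto)
  moreover have "D R w z" by (rule mono[OF sym[OF z(3)]]) (use z nonneg[OF z(2)] in auto)
  ultimately show ?thesis using z by blast
qed (use assms avoid.edge in metis)

text \<open>If no point of \<open>N\<close> lies between \<open>x\<close> and \<open>y\<close>, then
  a point \<open>z\<close> of \<open>S\<close> between them is not in \<open>N\<close>, and no point
  of \<open>N\<close> lies between \<open>x\<close> and \<open>z\<close> or between \<open>z\<close>
  and \<open>y\<close>: it would also lie between \<open>x\<close> and \<open>y\<close>. So a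
  generating pair splits at \<open>z\<close> into two generating pairs, and this carries over to
  concatenations.\<close>

lemma separates_avoid:
  assumes sep: "separates D S X (U - X)" and sub: "S \<subseteq> U" "X \<subseteq> U"
  shows "separates (avoid D U N) (S - N) (X - N) (U - X)"
proof -
  interpret av: closeness "avoid D U N" by (rule closeness_avoid)
  have "between (avoid D U N) (S - N) p x y" if "avoid D U N p x y" "x \<in> X" "y \<notin> X" for p x y
    using that
  proof (induction rule: avoid.induct)
    case (edge x y p)
    then obtain z a b where z: "z \<in> S" "D a x z" "D b z y" "a + b \<le> p"
      using sep sub unfolding separates_def between_def by blast
    have zN: "z \<notin> N" using z edge(4) unfolding between_def by blast
    have "\<not> between D N a x z"
    proof
      assume "between D N a x z"
      then obtain n a' b' where n: "n \<in> N" "D a' x n" "D b' n z" "a' + b' \<le> a" unfolding between_def by blast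
      have "D (b' + b) n y" "a' + (b' + b) \<le> p" using tri[OF n(3) z(3)] n z by auto
      then show False using n edge(4) unfolding between_def by blast
    qed
    moreover have "\<not> between D N b z y"
    proof
      assume "between D N b z y"
      then obtain n a' b' where n: "n \<in> N" "D a' z n" "D b' n y" "a' + b' \<le> b" unfolding between_def by blast
      have "D (a + a') x n" "(a + a') + b' \<le> p" using tri[OF z(2) n(2)] n z by auto
      then show False using n edge(4) unfolding between_def by blast
    qed
    ultimately have "avoid D U N a x z" "avoid D U N b z y"
      using edge z zN sub by (auto intro!: avoid.edge)
    then show ?case using z zN unfolding between_def by blast
  next
    case (refl p x) then show ?case by simp
  next
    case (trans p x y q z t)
    show ?case
    proof (cases "y \<in> X")
      case True
      then obtain w a b where w: "w \<in> S - N" "avoid D U N a y w" "avoid D U N b w z" "a + b \<le> q"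
        using trans unfolding between_def by blast
      have "avoid D U N (p + a) x w" "(p + a) + b \<le> t" using av.tri[OF trans(1) w(2)] w trans by auto
      then show ?thesis using w unfolding between_def by blast
    next
      case False
      then obtain w a b where w: "w \<in> S - N" "avoid D U N a x w" "avoid D U N b w y" "a + b \<le> p"
        using trans unfolding between_def by blast
      have "avoid D U N (b + q) w z" "a + (b + q) \<le> t" using av.tri[OF w(3) trans(2)] w trans by auto
      then show ?thesis using w unfolding between_def by blast
    qed
  qed
  then show ?thesis unfolding separates_def by blast
qed

text \<open>The ambient set \<open>U\<close> stays fixed while \<open>V\<close> shrinks to subtrees,
  so that one metric serves the whole recursion. The separation of \<open>V\<close> from the rest of
  \<open>U\<close> is what passes down through \<open>separates_extend\<close>.\<close>

lemma td_avoid: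
  assumes "td D Pc A V B" and Pc: "\<And>B. Pc B \<Longrightarrow> Pc' (B - N)" and A: "\<And>S. A S \<Longrightarrow> A' (S - N)"
    and "V \<subseteq> U" "separates D B V (U - V)"
  shows "td (avoid D U N) Pc' A' (V - N) (B - N)"
  using assms(1,4,5)
proof (induction rule: td.induct)
  case (node B V C)
  have sub: "V' \<subseteq> V" "B' \<subseteq> V'" if "(V', B') \<in> C" for V' B'
    using node.hyps(2) that td_bag_subset[OF node.hyps(3)[OF that]] by force+
  have sep: "separates D (B \<inter> B') V' (U - V')" if "(V', B') \<in> C" for V' B'
    by (rule separates_extend[OF node.prems(2)])
      (use sub[OF that] node.hyps(2) node.hyps(4)[OF that] in auto)
  let ?C = "(\<lambda>(V', B'). (V' - N, B' - N)) ` C"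
  show ?case
  proof (rule td.node)
    show "Pc' (B - N)" using Pc node by blast
    show "V - N = B - N \<union> \<Union> (fst ` ?C)"
      unfolding node.hyps(2) by (force simp: image_image split_beta)
  next
    fix V' B' assume "(V', B') \<in> ?C"
    then obtain V1 B1 where 1: "(V1, B1) \<in> C" "V' = V1 - N" "B' = B1 - N" by auto
    show "td (avoid D U N) Pc' A' V' B'"
      unfolding 1 by (rule node.IH[OF 1(1)]) 
        (use sub[OF 1(1)] node.prems separates_mono[OF sep[OF 1(1)]] in auto)
    have "(B - N) \<inter> B' = B \<inter> B1 - N" using 1 by auto
    moreover have "separates (avoid D U N) (B \<inter> B1 - N) V' (V - N - V')"
    proof -
      have "separates (avoid D U N) (B \<inter> B1 - N) (V1 - N) (U - V1)"
        by (rule separates_avoid[OF sep[OF 1(1)]]) (use sub[OF 1(1)] node.prems in auto)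
      then show ?thesis unfolding 1 by (rule separates_mono) (use node.prems in auto)
    qed
    ultimately show "A' ((B - N) \<inter> B') \<and> V' \<inter> (B - N) \<subseteq> B' \<and>
       separates (avoid D U N) ((B - N) \<inter> B') V' (V - N - V')"
      using A node.hyps(4)[OF 1(1)] 1 by auto
  next
    fix h h' assume "h \<in> ?C" "h' \<in> ?C" "h \<noteq> h'"
    then obtain g g' where "g \<in> C" "h = (fst g - N, snd g - N)" "g' \<in> C" "h' = (fst g' - N, snd g' - N)"
      by (auto simp: split_beta)
    with \<open>h \<noteq> h'\<close> have g: "g \<in> C" "g' \<in> C" "g \<noteq> g'" "fst h = fst g - N" "fst h' = fst g' - N"
      by auto
    then show "fst h \<inter> fst h' \<subseteq> B - N" using node.hyps(5)[of g g'] by auto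
  qed
qed

end

text \<open>The part \<open>W\<close> consists of the bags reachable from the root through adhesion sets that meet \<open>N\<close>;
  \<open>C\<close> collects the pieces \<open>V'\<close> cut off at the first adhesion sets \<open>S'\<close> missing \<open>N\<close>.\<close>

definition pruned where
  "pruned D Pc A E V B N \<longleftrightarrow> (\<exists>W C. td D Pc (\<lambda>S. A S \<and> S \<inter> N \<noteq> {}) W B \<and> V = W \<union> \<Union>(fst ` C) \<and>
    (\<forall>(V', S')\<in>C. A S' \<and> V' \<inter> W = S' \<and> S' \<inter> N = {} \<and> E V' S' \<and> separates D S' V' (V - V')) \<and>
    (\<forall>h\<in>C. \<forall>h'\<in>C. h \<noteq> h' \<longrightarrow> fst h \<inter> fst h' \<subseteq> W))"

text \<open>Children whose adhesion set meets \<open>N\<close> contribute their own pruned part to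
  \<open>W\<close> and their own pieces; every other child becomes a piece as a whole.\<close>

lemma (in closeness) pruned_node:
  assumes Pc: "Pc B" and V: "V = B \<union> \<Union>(fst ` C)"
    and td: "\<And>V' B'. (V', B') \<in> C \<Longrightarrow> td D Pc A V' B'"
    and adh: "\<And>V' B'. (V', B') \<in> C \<Longrightarrow> A (B \<inter> B') \<and> V' \<inter> B \<subseteq> B' \<and> separates D (B \<inter> B') V' (V - V')"
    and disj: "\<And>h h'. h \<in> C \<Longrightarrow> h' \<in> C \<Longrightarrow> h \<noteq> h' \<Longrightarrow> fst h \<inter> fst h' \<subseteq> B"
    and IH: "\<And>V' B'. (V', B') \<in> C \<Longrightarrow> pruned D Pc A E V' B' N"
    and E: "\<And>V' B'. (V', B') \<in> C \<Longrightarrow> E V' (B \<inter> B')"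
  shows "pruned D Pc A E V B N"
proof -
  define Q where "Q h W D' \<longleftrightarrow> td D Pc (\<lambda>S. A S \<and> S \<inter> N \<noteq> {}) W (snd h) \<and> fst h = W \<union> \<Union>(fst ` D') \<and>
    (\<forall>(V', S')\<in>D'. A S' \<and> V' \<inter> W = S' \<and> S' \<inter> N = {} \<and> E V' S' \<and> separates D S' V' (fst h - V')) \<and>
    (\<forall>h\<in>D'. \<forall>h'\<in>D'. h \<noteq> h' \<longrightarrow> fst h \<inter> fst h' \<subseteq> W)" for h W D'
  have "\<exists>W D'. Q h W D'" if "h \<in> C" for h
    using IH[of "fst h" "snd h"] that unfolding pruned_def Q_def by simp
  then obtain WW CC where WWCC: "\<And>h. h \<in> C \<Longrightarrow> Q h (WW h) (CC h)" by metis
  have WC: "\<And>h. h \<in> C \<Longrightarrow> td D Pc (\<lambda>S. A S \<and> S \<inter> N \<noteq> {}) (WW h) (snd h)"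
      "\<And>h. h \<in> C \<Longrightarrow> fst h = WW h \<union> \<Union>(fst ` CC h)"
      "\<And>h V' S'. h \<in> C \<Longrightarrow> (V', S') \<in> CC h \<Longrightarrow> A S' \<and> V' \<inter> WW h = S' \<and> S' \<inter> N = {} \<and> E V' S' \<and>
         separates D S' V' (fst h - V')"
      "\<And>h g g'. h \<in> C \<Longrightarrow> g \<in> CC h \<Longrightarrow> g' \<in> CC h \<Longrightarrow> g \<noteq> g' \<Longrightarrow> fst g \<inter> fst g' \<subseteq> WW h"
    subgoal for h using WWCC[of h] unfolding Q_def by simp
    subgoal for h using WWCC[of h] unfolding Q_def by simp
    subgoal for h V' S' using WWCC[of h] unfolding Q_def by auto
    subgoal for h g g' using WWCC[of h] unfolding Q_def by simp
    done
  define I where "I = {h \<in> C. B \<inter> snd h \<inter> N \<noteq> {}}"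
  define W where "W = B \<union> \<Union>(WW ` I)"
  define C' where "C' = \<Union>(CC ` I) \<union> (\<lambda>h. (fst h, B \<inter> snd h)) ` (C - I)"
  have IC: "I \<subseteq> C" by (auto simp: I_def)
  have sub: "WW h \<subseteq> fst h" "snd h \<subseteq> WW h" "snd h \<subseteq> fst h" "fst h \<subseteq> V" if "h \<in> C" for h
    using WC(2)[OF that] td_bag_subset[OF WC(1)[OF that]] that V by auto
  have adh': "A (B \<inter> snd h)" "fst h \<inter> B \<subseteq> snd h" "separates D (B \<inter> snd h) (fst h) (V - fst h)"
    if "h \<in> C" for h using adh[of "fst h" "snd h"] that by auto
  \<comment> \<open>Distinct children overlap only in \<open>B\<close>, so \<open>W\<close> meets
    the child \<open>h\<close> only in its own pruned part and in its root bag.\<close>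
  have inW: "fst h \<inter> W \<subseteq> WW h \<union> snd h" "h \<notin> I \<Longrightarrow> fst h \<inter> W \<subseteq> snd h \<inter> B" if "h \<in> C" for h
  proof -
    have *: "x \<in> snd h \<inter> B \<or> h \<in> I \<and> x \<in> WW h" if "x \<in> fst h" "x \<in> W" for x
    proof (cases "x \<in> B")
      case True then show ?thesis using adh'(2)[OF \<open>h \<in> C\<close>] that by auto
    next
      case False
      then obtain g where g: "g \<in> I" "x \<in> WW g"
        using \<open>x \<in> W\<close> unfolding W_def by blast
      then have "x \<in> fst g" using sub(1)[of g] IC by auto
      then have "g = h" using disj[of g h] g IC \<open>h \<in> C\<close> False that by auto
      then show ?thesis using g by simp
    qed
    show "fst h \<inter> W \<subseteq> WW h \<union> snd h" "h \<notin> I \<Longrightarrow> fst h \<inter> W \<subseteq> snd h \<inter> B" using * by blast+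
  qed
  have inW': "fst h \<inter> W = WW h" if "h \<in> I" for h
  proof -
    have "h \<in> C" using that IC by blast
    moreover have "WW h \<subseteq> W" using that by (auto simp: W_def)
    ultimately show ?thesis using inW(1)[of h] sub[of h] by blast
  qed
  have "WW h \<subseteq> V" if "h \<in> I" for h using sub(1)[of h] sub(4)[of h] IC that by blast
  then have WV: "W \<subseteq> V" using V by (auto simp: W_def)
  have tdW: "td D Pc (\<lambda>S. A S \<and> S \<inter> N \<noteq> {}) W B"
  proof (rule td.node[of Pc, OF Pc])
    show "W = B \<union> \<Union>(fst ` (\<lambda>h. (WW h, snd h)) ` I)" by (simp add: W_def image_image)
  next
    fix V' B' assume "(V', B') \<in> (\<lambda>h. (WW h, snd h)) ` I"
    then obtain h where h: "h \<in> I" "h \<in> C" "V' = WW h" "B' = snd h" using IC by auto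
    show "td D Pc (\<lambda>S. A S \<and> S \<inter> N \<noteq> {}) V' B'" using WC(1) h by simp
    have "separates D (B \<inter> snd h) (WW h) (W - WW h)"
      unfolding separates_def
    proof (intro ballI allI impI)
      fix x y p assume "x \<in> WW h" "y \<in> W - WW h" "D p x y"
      moreover have "y \<notin> fst h" using inW'[OF h(1)] calculation by blast
      ultimately show "between D (B \<inter> snd h) p x y"
        using adh'(3)[OF h(2)] sub(1)[OF h(2)] WV unfolding separates_def by blast
    qed
    then show "(A (B \<inter> B') \<and> B \<inter> B' \<inter> N \<noteq> {}) \<and> V' \<inter> B \<subseteq> B' \<and> separates D (B \<inter> B') V' (W - V')"
      using adh'[OF h(2)] h sub(1)[OF h(2)] by (auto simp: I_def)
  next
    fix g g' assume "g \<in> (\<lambda>h. (WW h, snd h)) ` I" "g' \<in> (\<lambda>h. (WW h, snd h)) ` I" "g \<noteq> g'"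
    then obtain h h' where "h \<in> I" "g = (WW h, snd h)" "h' \<in> I" "g' = (WW h', snd h')" by blast
    with \<open>g \<noteq> g'\<close> IC have "h \<in> C" "h' \<in> C" "h \<noteq> h'" "fst g = WW h" "fst g' = WW h'" by auto
    then show "fst g \<inter> fst g' \<subseteq> B" using disj[of h h'] sub(1)[of h] sub(1)[of h'] by auto
  qed
  have VWC: "V = W \<union> \<Union>(fst ` C')"
  proof
    show "V \<subseteq> W \<union> \<Union>(fst ` C')"
    proof
      fix x assume "x \<in> V"
      then consider "x \<in> B" | h where "h \<in> C" "x \<in> fst h" using V by auto
      then show "x \<in> W \<union> \<Union>(fst ` C')"
      proof cases
        case 2
        then show ?thesis using WC(2)[of h] by (cases "h \<in> I") (auto simp: W_def C'_def)
      qed (simp add: W_def)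
    qed
    have "\<Union>(fst ` CC h) \<subseteq> V" if "h \<in> I" for h using WC(2)[of h] sub(4)[of h] that IC by blast
    moreover have "fst h \<subseteq> V" if "h \<in> C" for h using sub(4)[OF that] .
    ultimately have "\<Union>(fst ` C') \<subseteq> V" unfolding C'_def by fastforce
    then show "W \<union> \<Union>(fst ` C') \<subseteq> V" using WV by blast
  qed
  have props: "A S' \<and> V' \<inter> W = S' \<and> S' \<inter> N = {} \<and> E V' S' \<and> separates D S' V' (V - V')"
    if "(V', S') \<in> C'" for V' S'
  proof (cases "(V', S') \<in> \<Union>(CC ` I)")
    case True
    then obtain h where h: "h \<in> I" "(V', S') \<in> CC h" by auto
    have hC: "h \<in> C" using h IC by auto
    note p = WC(3)[OF hC h(2)]
    have V'h: "V' \<subseteq> fst h" using WC(2)[OF hC] h(2) by force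
    have "V' \<inter> W = S'" using inW'[OF h(1)] V'h p by blast
    moreover have "separates D S' V' (V - V')"
    \<comment> \<open>A piece inside a child is separated only within that child; the root bag of
      the child separates it from the rest of \<open>V\<close>.\<close>
    proof (rule separates_extend[of "snd h" "fst h"])
      show "separates D (snd h) (fst h) (V - fst h)" 
        by (rule separates_mono[OF adh'(3)[OF hC]]) auto
      show "V' \<inter> snd h \<subseteq> S'" using p sub(2)[OF hC] by blast
    qed (use p V'h sub[OF hC] in auto)
    ultimately show ?thesis using p by blast
  next
    case False
    then obtain h where h: "h \<in> C" "h \<notin> I" "V' = fst h" "S' = B \<inter> snd h"
      using \<open>(V', S') \<in> C'\<close> unfolding C'_def by auto
    have "V' \<inter> W = S'" using inW(2)[OF h(1,2)] sub(3)[OF h(1)] h by (auto simp: W_def)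
    then show ?thesis using adh'[OF h(1)] E[of "fst h" "snd h"] h by (auto simp: I_def)
  qed
  have pairs: "fst g \<inter> fst g' \<subseteq> W" if g: "g \<in> C'" "g' \<in> C'" "g \<noteq> g'" for g g'
  proof -
    have ex: "\<exists>h\<in>C. fst g \<subseteq> fst h \<and> (h \<in> I \<and> g \<in> CC h \<or> g = (fst h, B \<inter> snd h) \<and> h \<notin> I)" if "g \<in> C'" for g
    proof (cases "g \<in> \<Union>(CC ` I)")
      case True
      then obtain h where h: "h \<in> I" "g \<in> CC h" by auto
      then show ?thesis using IC WC(2)[of h] by blast
    next
      case False
      then show ?thesis using that by (force simp: C'_def)
    qed
    obtain h h' where h: "h \<in> C" "fst g \<subseteq> fst h" "h \<in> I \<and> g \<in> CC h \<or> g = (fst h, B \<inter> snd h) \<and> h \<notin> I"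
      and h': "h' \<in> C" "fst g' \<subseteq> fst h'" "h' \<in> I \<and> g' \<in> CC h' \<or> g' = (fst h', B \<inter> snd h') \<and> h' \<notin> I"
      using ex[OF g(1)] ex[OF g(2)] by blast
    show ?thesis
    proof (cases "h = h'")
      case True
      then have "h \<in> I" "g \<in> CC h" "g' \<in> CC h" using h h' g by auto
      then show ?thesis using WC(4)[OF h(1) _ _ g(3)] by (auto simp: W_def)
    next
      case False
      then show ?thesis using disj[OF h(1) h'(1)] h h' by (auto simp: W_def)
    qed
  qed
  show ?thesis
    unfolding pruned_def
  proof (intro exI[of _ W] exI[of _ C'] conjI ballI impI)
    fix p assume "p \<in> C'"
    then show "case p of (V', S') \<Rightarrow> A S' \<and> V' \<inter> W = S' \<and> S' \<inter> N = {} \<and> E V' S' \<and> separates D S' V' (V - V')"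
      using props[of "fst p" "snd p"] by (simp add: split_beta)
  qed (rule tdW VWC pairs; assumption?)+
qed

text \<open>Structural induction in a form adapted to pruning: to prove \<open>E\<close> for a tree
  it may be assumed for the pieces cut off by any \<open>N\<close>, each of which lies strictly
  further down.\<close>

lemma (in closeness) td_prune_induct:
  assumes "td D Pc A V B"
    and step: "\<And>V B S. (\<And>N. pruned D Pc A E V B N) \<Longrightarrow> S \<subseteq> B \<Longrightarrow> A S \<Longrightarrow> E V S"
  shows "S \<subseteq> B \<Longrightarrow> A S \<Longrightarrow> E V S"
proof -
  have "pruned D Pc A E V B N" for N
    using assms(1)
  proof (induction arbitrary: N rule: td.induct)
    case (node B V C)
    show ?case
    proof (rule pruned_node[of Pc, OF node.hyps(1,2)])
      show "E V' (B \<inter> B')" if "(V', B') \<in> C" for V' B'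
        using step[OF node.IH[OF that]] node.hyps(4)[OF that] by blast
    qed (rule node; assumption)+
  qed
  then show "S \<subseteq> B \<Longrightarrow> A S \<Longrightarrow> E V S" using step by blast
qed

section \<open>Linear control and extension of boundary colourings\<close>

definition controlled :: "(real \<Rightarrow> 'a \<Rightarrow> 'a \<Rightarrow> bool) \<Rightarrow> (real \<Rightarrow> 'a \<Rightarrow> 'a \<Rightarrow> bool) \<Rightarrow> nat \<Rightarrow> real \<Rightarrow> 'a set \<Rightarrow> bool" where
  "controlled D dl m K X \<longleftrightarrow>
     (\<forall>r>0. \<exists>c. (\<forall>x\<in>X. c x < m) \<and> (\<forall>x y. chain D X c r x y \<longrightarrow> dl (K * r) x y))"

text \<open>A chain of the colour of a point in \<open>low\<close> cannot leave \<open>low\<close>: colour 1 is interrupted by the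
  collar at distance \<open>2 r\<close> to \<open>3 r\<close> from \<open>S\<close>, every other colour by the one at \<open>r\<close> to \<open>2 r\<close>.\<close>

definition low :: "(real \<Rightarrow> 'a \<Rightarrow> 'a \<Rightarrow> bool) \<Rightarrow> real \<Rightarrow> 'a set \<Rightarrow> 'a set \<Rightarrow> ('a \<Rightarrow> nat) \<Rightarrow> 'a set" where
  "low D r V S c = {x \<in> V. \<not> near D S (if c x = 1 then 2 * r else r) x}"

text \<open>The diameter bound concerns chains inside \<open>low\<close>, which cannot leave the
  piece. Chains that run closer to \<open>S\<close> may continue outside and are bounded one level
  up by \<open>glue_bound\<close>.\<close>

definition extension where
  "extension D dl m r L V S g c \<longleftrightarrow> (\<forall>x\<in>V. c x < m) \<and> (\<forall>s\<in>S. c s = g s) \<and>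
     (\<forall>x\<in>V - S. near D S r x \<longrightarrow> (\<exists>s\<in>S. D r x s \<and> c x = g s)) \<and>
     (\<forall>x\<in>V. \<not> near D S r x \<and> near D S (2 * r) x \<longrightarrow> c x = 1) \<and>
     (\<forall>x\<in>V. \<not> near D S (2 * r) x \<and> near D S (3 * r) x \<longrightarrow> c x = 0) \<and>
     (\<forall>x y. chain D (low D r V S c) c r x y \<longrightarrow> dl L x y)"

definition extendable where
  "extendable D dl m r L V S \<longleftrightarrow> (\<forall>g. (\<forall>s\<in>S. g s < m) \<longrightarrow> (\<exists>c. extension D dl m r L V S g c))"

text \<open>In units of \<open>r\<close>: \<open>q\<close> is the scale \<open>R\<close> of
  \<open>glue_bound\<close>, \<open>e\<close> is the \<open>E\<close> of \<open>region_bound\<close>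
  for a ball of radius 3 with control \<open>K * q\<close>, \<open>f\<close> is the bound that
  results for chains in \<open>W\<close>, and the final sum is that of
  \<open>glue_bound\<close>.\<close>

definition step_const :: "nat \<Rightarrow> real \<Rightarrow> real" where
  "step_const k K = (let q = 5 * real (k * k) + 4; e = 3 + q + K * q;
     f = 2 * (2 * e + (2 * e + q) * real (k * k)) in 2 + (q + f) + (5 * real (k * k) + 2))"

context two_closeness
begin

text \<open>Leaving \<open>V'\<close> would require \<open>u\<close> to be within \<open>r\<close>
  of \<open>S\<close>. Entering the forbidden zone would put \<open>u\<close> in the collar just
  outside it, whose colour differs from that of \<open>u\<close>.\<close>

lemma low_step:
  assumes sep: "separates D S V' (V - V')" and r: "0 < r"
    and z2: "\<forall>x\<in>V'. \<not> near D S r x \<and> near D S (2 * r) x \<longrightarrow> c x = 1"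
    and z3: "\<forall>x\<in>V'. \<not> near D S (2 * r) x \<and> near D S (3 * r) x \<longrightarrow> c x = 0"
    and u: "u \<in> low D r V' S c" and v: "v \<in> V" and cuv: "c u = c v" and D: "D r u v"
  shows "v \<in> low D r V' S c"
proof -
  have uV: "u \<in> V'" and un: "\<not> near D S (if c u = 1 then 2 * r else r) u" using u by (auto simp: low_def)
  have near_mono: "near D S q x" if "near D S p x" "p \<le> q" for p q x
    using that mono unfolding near_def by blast
  have vV: "v \<in> V'"
  proof (rule ccontr)
    assume "v \<notin> V'"
    then have "between D S r u v" using sep uV v D unfolding separates_def by blast
    then obtain z a b where z: "z \<in> S" "D a u z" "D b z v" "a + b \<le> r" unfolding between_def by blast
    have "near D S r u" using z mono[OF z(2), of r] nonneg[OF z(3)] unfolding near_def by auto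
    then show False using un near_mono[of r u "2 * r"] r by (auto split: if_splits)
  qed
  moreover have "\<not> near D S (if c v = 1 then 2 * r else r) v"
  proof
    assume "near D S (if c v = 1 then 2 * r else r) v"
    then obtain s where s: "s \<in> S" "D (if c v = 1 then 2 * r else r) v s" unfolding near_def by blast
    have "near D S (r + (if c v = 1 then 2 * r else r)) u"
      using tri[OF D s(2)] s(1) unfolding near_def by blast
    then show False using un z2 z3 uV cuv by (auto split: if_splits)
  qed
  ultimately show ?thesis by (simp add: low_def)
qed

text \<open>The induction hypothesis is applied to \<open>W\<close> without the ball, in the
  avoiding metric but with diameters still measured by \<open>dl\<close>. The conclusion covers
  every \<open>c\<close> that agrees with \<open>c0\<close> off the ball, so the ball remains free
  for the boundary colours and collars.\<close>

lemma region_colouring: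
  assumes r: "0 < r" and K: "0 \<le> K" and R: "R = q * r" and q: "0 < q"
    and S: "finite S" "card S \<le> k"
    and IH: "\<forall>D' V B. two_closeness D' dl \<longrightarrow>
        td D' (controlled D' dl m K0) (\<lambda>S. finite S \<and> card S < k) V B \<longrightarrow> controlled D' dl m K V"
    and W: "td D (controlled D dl m K0)
        (\<lambda>S'. (finite S' \<and> card S' < Suc k) \<and> S' \<inter> {x. near D S (3 * r) x} \<noteq> {}) W B"
    and e: "e = 3 + q + K * q" and f: "f = 2 * (2 * e + (2 * e + q) * real (k * k))"
  shows "\<exists>c0. (\<forall>x\<in>W - {x. near D S (3 * r) x}. c0 x < m) \<and>
    (\<forall>c. (\<forall>x\<in>W - {x. near D S (3 * r) x}. c x = c0 x) \<longrightarrow>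
       (\<forall>x y. chain D W c R x y \<longrightarrow> dl (f * r) x y))"
proof -
  let ?N = "{x. near D S (3 * r) x}"
  let ?D' = "avoid D W ?N"
  interpret av: closeness ?D' by (rule closeness_avoid)
  interpret av2: two_closeness ?D' dl by unfold_locales (use avoid_imp sub in blast)
  have R0: "0 < R" using R q r by simp
  have tdN: "td ?D' (controlled ?D' dl m K0) (\<lambda>S. finite S \<and> card S < k) (W - ?N) (B - ?N)"
  proof (rule td_avoid[OF W])
    fix B assume B: "controlled D dl m K0 B"
    show "controlled ?D' dl m K0 (B - ?N)"
      unfolding controlled_def
    proof (intro allI impI)
      fix t :: real assume "t > 0"
      then obtain c where c: "\<forall>x\<in>B. c x < m" "\<And>x y. chain D B c t x y \<Longrightarrow> dl (K0 * t) x y"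
        using B unfolding controlled_def by blast
      have "chain D B c t x y" if "chain ?D' (B - ?N) c t x y" for x y
        using that by (rule chain_mono) (use avoid_imp in blast)
      then show "\<exists>c. (\<forall>x\<in>B - ?N. c x < m) \<and> (\<forall>x y. chain ?D' (B - ?N) c t x y \<longrightarrow> dl (K0 * t) x y)"
        using c by blast
    qed
  next
    \<comment> \<open>Each adhesion set inside \<open>W\<close> meets the ball and loses a point:
      this is where the induction parameter drops.\<close>
    fix S' assume "(finite S' \<and> card S' < Suc k) \<and> S' \<inter> ?N \<noteq> {}"
    moreover then have "card (S' - ?N) < card S'" by (intro psubset_card_mono) auto
    ultimately show "finite (S' - ?N) \<and> card (S' - ?N) < k" by auto
  qed (auto simp: separates_def)
  have "controlled ?D' dl m K (W - ?N)" using IH av2.two_closeness_axioms tdN by blast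
  then obtain c0 where c0: "\<forall>x\<in>W - ?N. c0 x < m"
      "\<And>x y. chain ?D' (W - ?N) c0 R x y \<Longrightarrow> dl (K * R) x y"
    using R0 unfolding controlled_def by blast
  have "dl (f * r) x y" if c: "\<forall>x\<in>W - ?N. c x = c0 x" and ch: "chain D W c R x y" for c x y
  proof -
    have "dl (2 * (2 * (3 * r + R + K * R) + (2 * (3 * r + R + K * R) + R) * real (k * k))) x y"
    proof (rule region_bound[where D' = ?D' and W = W and c = c, OF S])
      show "0 \<le> 3 * r" "0 \<le> R" "0 \<le> K * R" using r R0 K by auto
      show "?D' R u w \<or> (\<exists>z. near D S (3 * r) z \<and> D R u z \<and> D R w z)"
        if "u \<in> W" "w \<in> W" "\<not> near D S (3 * r) u" "\<not> near D S (3 * r) w" "D R u w" for u w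
        using avoid_short[of u W ?N w R] that by auto
      show "dl (K * R) u v" if "chain ?D' (W - ?N) c R u v" for u v
      proof (rule c0(2), rule chain_mono[OF that])
        fix u v assume "u \<in> W - ?N" "v \<in> W - ?N" "c u = c v" "?D' R u v"
        then show "u \<in> W - ?N \<and> v \<in> W - ?N \<and> c0 u = c0 v \<and> ?D' R u v" using c by auto
      qed
    qed (rule ch)
    moreover have "2 * (2 * (3 * r + R + K * R) + (2 * (3 * r + R + K * R) + R) * real (k * k)) = f * r"
      unfolding f e R by (simp add: algebra_simps)
    ultimately show ?thesis by simp
  qed
  then show ?thesis using c0(1) by blast
qed

text \<open>One round of the colouring: \<open>W\<close> receives the boundary colours and collars
  inside the \<open>3 * r\<close>-ball and the colours of \<open>region_colouring\<close> outside
  it; then each piece is coloured by extending the colours on its adhesion set.\<close>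

lemma extend_step:
  assumes r: "0 < r" and K: "0 \<le> K" and m: "2 \<le> m"
    and IH: "\<forall>D' V B. two_closeness D' dl \<longrightarrow>
        td D' (controlled D' dl m K0) (\<lambda>S. finite S \<and> card S < k) V B \<longrightarrow> controlled D' dl m K V"
    and pr: "\<And>N. pruned D (controlled D dl m K0) (\<lambda>S. finite S \<and> card S < Suc k)
        (extendable D dl m r (step_const k K * r)) V B N"
    and SB: "S \<subseteq> B" and AS: "finite S \<and> card S < Suc k"
  shows "extendable D dl m r (step_const k K * r) V S"
  unfolding extendable_def
proof (intro allI impI)
  fix g assume g: "\<forall>s\<in>S. g s < m"
  define q where "q = 5 * real (k * k) + 4"
  define R where "R = q * r"
  define e where "e = 3 + q + K * q"
  define f where "f = 2 * (2 * e + (2 * e + q) * real (k * k))"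
  have q0: "0 < q" by (simp add: q_def add_nonneg_pos)
  have e0: "0 \<le> e" using q0 K by (simp add: e_def)
  have f0: "0 \<le> f" using q0 e0 by (simp add: f_def)
  have R0: "0 \<le> R" using q0 r by (simp add: R_def)
  let ?N = "{x. near D S (3 * r) x}"
  obtain W C where tdW: "td D (controlled D dl m K0)
        (\<lambda>S'. (finite S' \<and> card S' < Suc k) \<and> S' \<inter> ?N \<noteq> {}) W B"
    and V: "V = W \<union> \<Union>(fst ` C)"
    and C': "\<forall>(V', S')\<in>C. (finite S' \<and> card S' < Suc k) \<and> V' \<inter> W = S' \<and> S' \<inter> ?N = {} \<and>
       extendable D dl m r (step_const k K * r) V' S' \<and> separates D S' V' (V - V')"
    and disj': "\<forall>h\<in>C. \<forall>h'\<in>C. h \<noteq> h' \<longrightarrow> fst h \<inter> fst h' \<subseteq> W"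
    using pr[of ?N] unfolding pruned_def by (elim exE conjE) (rule that)
  have C: "(finite S' \<and> card S' < Suc k) \<and> V' \<inter> W = S' \<and> S' \<inter> ?N = {} \<and>
       extendable D dl m r (step_const k K * r) V' S' \<and> separates D S' V' (V - V')"
    if "(V', S') \<in> C" for V' S' using bspec[OF C' that] by simp
  have disj: "fst h \<inter> fst h' \<subseteq> W" if "h \<in> C" "h' \<in> C" "h \<noteq> h'" for h h'
    using disj' that by simp
  have SW: "S \<subseteq> W" using SB td_bag_subset[OF tdW] by blast
  have "finite S" "card S \<le> k" using AS by auto
  from region_colouring[OF r K R_def q0 this IH tdW e_def f_def]
  obtain c0 where c0: "\<forall>x\<in>W - ?N. c0 x < m"
      "\<And>c x y. \<forall>x\<in>W - ?N. c x = c0 x \<Longrightarrow> chain D W c R x y \<Longrightarrow> dl (f * r) x y"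
    by blast
  have near_mono: "near D T b x" if "near D T a x" "a \<le> b" for a b x T
    using that mono unfolding near_def by blast
  have near_self: "near D T a x" if "x \<in> T" "0 \<le> a" for a x T
    using that refl unfolding near_def by blast
  \<comment> \<open>The cases are tried from the inside out; points of \<open>S\<close> come first,
    since they must keep their own colour rather than that of some neighbour in
    \<open>S\<close>.\<close>
  define cW where "cW x = (if x \<in> S then g x else if near D S r x then g (SOME s. s \<in> S \<and> D r x s)
     else if near D S (2 * r) x then 1 else if near D S (3 * r) x then 0 else c0 x)" for x
  have some: "(SOME s. s \<in> S \<and> D r x s) \<in> S" "D r x (SOME s. s \<in> S \<and> D r x s)" if "near D S r x" for x
    using someI_ex[of "\<lambda>s. s \<in> S \<and> D r x s"] that unfolding near_def by auto
  have cWm: "cW x < m" if "x \<in> W" for x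
    using that g some c0(1) m unfolding cW_def by auto
  have "\<exists>d. extension D dl m r (step_const k K * r) (fst h) (snd h) cW d" if "h \<in> C" for h
  proof -
    have 1: "extendable D dl m r (step_const k K * r) (fst h) (snd h)" "fst h \<inter> W = snd h"
      using C[of "fst h" "snd h"] that by auto
    have "\<forall>s\<in>snd h. cW s < m" using cWm 1(2) by blast
    then show ?thesis using 1(1) unfolding extendable_def by blast
  qed
  then obtain ch where
    chE: "\<And>h. h \<in> C \<Longrightarrow> extension D dl m r (step_const k K * r) (fst h) (snd h) cW (ch h)"
    by metis
  note ch = chE[unfolded extension_def, THEN conjunct1, rule_format]
    chE[unfolded extension_def, THEN conjunct2, THEN conjunct1, rule_format]
    chE[unfolded extension_def, THEN conjunct2, THEN conjunct2, THEN conjunct1, rule_format]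
    chE[unfolded extension_def, THEN conjunct2, THEN conjunct2, THEN conjunct2, THEN conjunct1, rule_format]
    chE[unfolded extension_def, THEN conjunct2, THEN conjunct2, THEN conjunct2, THEN conjunct2,
      THEN conjunct1, rule_format]
    chE[unfolded extension_def, THEN conjunct2, THEN conjunct2, THEN conjunct2, THEN conjunct2,
      THEN conjunct2, rule_format]
  have inter: "fst h \<inter> W = snd h" if "h \<in> C" for h using C[of "fst h" "snd h"] that by auto
  \<comment> \<open>Outside \<open>W\<close> a point lies in only one piece, so the choice of
    \<open>h\<close> is forced.\<close>
  define c where "c x = (if x \<in> W then cW x else ch (SOME h. h \<in> C \<and> x \<in> fst h) x)" for x
  have agree: "c x = ch h x" if "h \<in> C" "x \<in> fst h" for h x
  proof (cases "x \<in> W")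
    case True
    then have "x \<in> snd h" using inter that by blast
    then show ?thesis using ch(2) that True by (simp add: c_def)
  next
    case False
    have "(SOME h. h \<in> C \<and> x \<in> fst h) \<in> C \<and> x \<in> fst (SOME h. h \<in> C \<and> x \<in> fst h)"
      using someI_ex[of "\<lambda>h. h \<in> C \<and> x \<in> fst h"] that by blast
    then have "(SOME h. h \<in> C \<and> x \<in> fst h) = h" using disj[of _ h] that False by blast
    then show ?thesis using False by (simp add: c_def)
  qed
  have cW_c: "c x = cW x" if "x \<in> W" for x using that by (simp add: c_def)
  have c0c: "\<forall>x\<in>W - ?N. c x = c0 x"
  proof
    fix x assume x: "x \<in> W - ?N"
    then have "\<not> near D S r x" "\<not> near D S (2 * r) x" "x \<notin> S"
      using near_mono[of S r x "3 * r"] near_mono[of S "2 * r" x "3 * r"] near_self[of x S "3 * r"] r by auto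
    then show "c x = c0 x" using x by (simp add: cW_c cW_def)
  qed
  \<comment> \<open>A point of a piece within \<open>3 * r\<close> of \<open>S\<close> would be
    joined to \<open>S\<close> through the adhesion set of the piece, which would then meet the
    ball.\<close>
  have NW: "x \<in> W" if "x \<in> V" "near D S (3 * r) x" for x
  proof (rule ccontr)
    assume "x \<notin> W"
    then obtain h where h: "h \<in> C" "x \<in> fst h" using V \<open>x \<in> V\<close> by auto
    have p: "fst h \<inter> W = snd h" "snd h \<inter> ?N = {}" "separates D (snd h) (fst h) (V - fst h)"
      using C[of "fst h" "snd h"] h by auto
    obtain s where s: "s \<in> S" "D (3 * r) x s" using \<open>near D S (3 * r) x\<close> unfolding near_def by blast
    have "s \<notin> fst h" using p s SW near_self[of s S "3 * r"] r by auto
    then have "between D (snd h) (3 * r) x s"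
      using p(3) h s SW V unfolding separates_def by blast
    then obtain z a b where z: "z \<in> snd h" "D a x z" "D b z s" "a + b \<le> 3 * r" unfolding between_def by blast
    have "D (3 * r) z s" using mono[OF z(3), of "3 * r"] nonneg[OF z(2)] z(4) by auto
    then have "z \<in> ?N" using s unfolding near_def by blast
    then show False using p z by blast
  qed
  have bound: "dl (step_const k K * r) x y" if cxy: "chain D (low D r V S c) c r x y" for x y
  proof (cases "x = y")
    case True
    have "0 \<le> step_const k K * r"
      using q0 f0 r unfolding step_const_def Let_def q_def[symmetric] e_def[symmetric] f_def[symmetric]
      by (intro mult_nonneg_nonneg add_nonneg_nonneg) auto
    then show ?thesis using True outer.refl by simp
  next
    case neq: False
    let ?low = "\<lambda>h. low D r (fst h) (snd h) c"
    have step_low: "v \<in> ?low h" if "h \<in> C" "u \<in> ?low h" "v \<in> V" "c u = c v" "D r u v" for h u v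
    proof (rule low_step[OF _ r _ _ that(2,3,4,5)])
      show "separates D (snd h) (fst h) (V - fst h)" using C[of "fst h" "snd h"] that(1) by simp
    qed (use ch(4,5)[OF that(1)] agree[OF that(1)] in auto)
    have lowV: "low D r V S c \<subseteq> V" by (auto simp: low_def)
    have xV: "x \<in> V" using chain_mem[OF cxy] neq lowV by auto
    \<comment> \<open>A chain that starts in the \<open>low\<close> part of a piece stays there and
      is bounded by the colouring of that piece. Otherwise, by symmetry of jumps, it never enters
      such a part; it then lives in \<open>W\<close> and \<open>2 * r\<close>-collars, as
      \<open>glue_bound\<close> requires.\<close>
    show ?thesis
    proof (cases "\<exists>h\<in>C. x \<in> ?low h")
      case True
      then obtain h where h: "h \<in> C" "x \<in> ?low h" by blast
      from cxy have "chain D (?low h) c r x y \<and> y \<in> ?low h"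
      proof (induction rule: chain_induct)
        case refl then show ?case using h chain_refl by metis
      next
        case (step u v)
        have "v \<in> ?low h" using step_low[OF h(1), of u v] step lowV by blast
        then show ?case using step chain_step[of D "?low h" c r x u v] by blast
      qed
      then have "chain D (?low h) c r x y" by simp
      then have "chain D (low D r (fst h) (snd h) (ch h)) (ch h) r x y"
        by (rule chain_mono) (use agree[OF h(1)] in \<open>auto simp: low_def\<close>)
      then show ?thesis using ch(6)[OF h(1)] by blast
    next
      case False
      define Z where "Z = {v \<in> V. \<forall>h\<in>C. v \<notin> ?low h}"
      have xZ: "x \<in> Z" using False xV by (simp add: Z_def)
      from cxy have "chain D Z c r x y \<and> y \<in> Z"
      proof (induction rule: chain_induct)
        case refl then show ?case using xZ chain_refl by metis
      next
        case (step u v)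
        have uv: "u \<in> V" "v \<in> V" using step lowV by auto
        have "v \<in> Z"
          using step_low[of _ v u] step sym[OF step(5)] uv unfolding Z_def by auto
        then show ?case using step chain_step[of D Z c r x u v] by blast
      qed
      then have cZ: "chain D Z c r x y" by simp
      have "dl (2 * r + ((5 * real (k * k) + 4) * r + f * r) + (5 * r * real (k * k) + 2 * r)) x y"
      proof (rule glue_bound[where C = C and V = V and W = W and Z = Z and c = c])
        show "0 \<le> r" "0 \<le> f * r" using r f0 by auto
        show "finite S' \<and> card S' \<le> k \<and> V' \<inter> W = S'" if "(V', S') \<in> C" for V' S'
          using C[OF that] by auto
        show "separates D S' V' (V - V')" if "(V', S') \<in> C" for V' S'
          using C[OF that] by auto
        show "\<exists>s\<in>S'. D r v s \<and> c s = c v" if h: "(V', S') \<in> C" "v \<in> V'" "near D S' r v" for V' S' v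
        proof (cases "v \<in> S'")
          case True then show ?thesis using refl r by (intro bexI[of _ v]) auto
        next
          case False
          then obtain s where "s \<in> S'" "D r v s" "ch (V', S') v = cW s"
            using ch(3)[OF h(1)] h by auto
          moreover have "s \<in> W" using inter[OF h(1)] \<open>s \<in> S'\<close> by auto
          ultimately show ?thesis using agree[OF h(1)] h cW_c by auto
        qed
        show "dl (f * r) u v" if "chain D W c ((5 * real (k * k) + 4) * r) u v" for u v
          using c0(2)[OF c0c] that unfolding R_def q_def by blast
        show "v \<in> W \<or> (\<exists>V' S'. (V', S') \<in> C \<and> v \<in> V' \<and> near D S' (2 * r) v)" if "v \<in> Z" for v
        proof (cases "v \<in> W")
          case False
          then obtain h where h: "h \<in> C" "v \<in> fst h" using V \<open>v \<in> Z\<close> by (auto simp: Z_def)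
          then have "near D (snd h) (2 * r) v"
            using \<open>v \<in> Z\<close> near_mono[of "snd h" r v "2 * r"] r by (auto simp: Z_def low_def split: if_splits)
          then show ?thesis using h by (metis prod.collapse)
        qed simp
      qed (use V disj xZ cZ in auto)
      moreover have "2 * r + ((5 * real (k * k) + 4) * r + f * r) + (5 * r * real (k * k) + 2 * r) =
          step_const k K * r"
        unfolding step_const_def Let_def q_def[symmetric] e_def[symmetric] f_def[symmetric]
        by (simp add: q_def algebra_simps)
      ultimately show ?thesis by simp
    qed
  qed
  show "\<exists>c. extension D dl m r (step_const k K * r) V S g c"
    unfolding extension_def
  proof (intro exI[of _ c] conjI ballI allI impI)
    show "c x < m" if "x \<in> V" for x
      using that V cWm cW_c agree ch(1) by (cases "x \<in> W") auto
    show "c s = g s" if "s \<in> S" for s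
      using that SW cW_c[of s] by (auto simp: cW_def)
    \<comment> \<open>The three zones around \<open>S\<close> lie in \<open>W\<close>, so their
      colours are those prescribed by \<open>cW\<close>.\<close>
    have nr: "x \<in> W" if "x \<in> V" "near D S a x" "a \<le> 3 * r" for x a
      using NW[OF that(1) near_mono[OF that(2,3)]] .
    show "\<exists>s\<in>S. D r x s \<and> c x = g s" if "x \<in> V - S" "near D S r x" for x
      using that nr[of x r] r some[of x] cW_c[of x] by (intro bexI[of _ "SOME s. s \<in> S \<and> D r x s"]) (auto simp: cW_def)
    show "c x = 1" if "x \<in> V" "\<not> near D S r x \<and> near D S (2 * r) x" for x
      using that nr[of x "2 * r"] r cW_c[of x] near_self[of x S r] by (auto simp: cW_def)
    show "c x = 0" if "x \<in> V" "\<not> near D S (2 * r) x \<and> near D S (3 * r) x" for x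
      using that nr[of x "3 * r"] r cW_c[of x] near_self[of x S "2 * r"] near_mono[of S r x "2 * r"]
      by (auto simp: cW_def)
  qed (rule bound)
qed

end

text \<open>The constant is chosen before the metrics, hence uniform. Two metrics are needed because
  the induction replaces \<open>D\<close> by an avoiding metric while diameters remain measured in
  the original one.\<close>

lemma td_controlled:
  fixes K0 :: real
  assumes m: "2 \<le> m" and K0: "0 < K0"
  shows "\<exists>K>0. \<forall>dl D V (B :: 'a set). two_closeness D dl \<longrightarrow>
      td D (controlled D dl m K0) (\<lambda>S. finite S \<and> card S < k) V B \<longrightarrow> controlled D dl m K V"
proof (induction k)
  case 0
  have "controlled D dl m K0 V"
    if "td D (controlled D dl m K0) (\<lambda>S. finite S \<and> card S < 0) V B" for D dl :: "real \<Rightarrow> 'a \<Rightarrow> 'a \<Rightarrow> bool" and V B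
    using that
  proof cases
    case (node C)
    \<comment> \<open>With the strict bound 0 not even an empty adhesion set is allowed, so the root
      is the only bag.\<close>
    then have "C = {}" by auto
    then show ?thesis using node by simp
  qed
  then show ?case using K0 by blast
next
  case (Suc k)
  then obtain K where K: "K > 0" and IH: "\<forall>dl D V (B :: 'a set). two_closeness D dl \<longrightarrow>
      td D (controlled D dl m K0) (\<lambda>S. finite S \<and> card S < k) V B \<longrightarrow> controlled D dl m K V"
    by blast
  have q0: "0 \<le> K * (5 * real (k * k) + 4)" using K by (intro mult_nonneg_nonneg add_nonneg_nonneg) auto
  have pos: "step_const k K > 0"
    unfolding step_const_def Let_def using q0
    by (intro add_pos_nonneg add_nonneg_nonneg mult_nonneg_nonneg) (use K in auto)
  have "controlled D dl m (step_const k K) V"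
    if "two_closeness D dl" and td: "td D (controlled D dl m K0) (\<lambda>S. finite S \<and> card S < Suc k) V B"
    for D dl V and B :: "'a set"
    unfolding controlled_def
  proof (intro allI impI)
    interpret two_closeness D dl by fact
    fix r :: real assume r: "r > 0"
    \<comment> \<open>With an empty boundary no point is near it, so \<open>low\<close> is all of
      \<open>V\<close> and the bound covers every chain.\<close>
    have "extendable D dl m r (step_const k K * r) V {}"
      by (rule td_prune_induct[OF td extend_step[OF r less_imp_le[OF K] m spec[OF IH]]]) auto
    then obtain c where "\<forall>x\<in>V. c x < m" 
      "\<forall>x y. chain D (low D r V {} c) c r x y \<longrightarrow> dl (step_const k K * r) x y"
      unfolding extendable_def extension_def by blast
    moreover have "low D r V {} c = V" by (simp add: low_def near_def)
    ultimately show "\<exists>c. (\<forall>x\<in>V. c x < m) \<and> (\<forall>x y. chain D V c r x y \<longrightarrow> dl (step_const k K * r) x y)"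
      by auto
  qed
  then show ?case using pos by blast
qed

section \<open>Distances in weighted graphs\<close>

lemma path_length_simps [simp]:
  "path_length G [] = 0" "path_length G [x] = 0"
  "path_length G (x # y # p) = weight G {x, y} + path_length G (y # p)"
  by (simp_all add: path_length_def)

lemma path_length_split: "path_length G (a @ x # b) = path_length G (a @ [x]) + path_length G (x # b)"
  by (induction a rule: induct_list012) (auto simp: add.assoc)

lemma path_split:
  assumes "path G u (a @ x # b) v"
  shows "path G u (a @ [x]) x" "path G x (x # b) v"
  using assms by (auto simp: path_def successively_append_iff hd_append)

lemma path_Cons:
  "path G u (x # y # p) v \<longleftrightarrow> u = x \<and> x \<in> verts G \<and> x \<notin> set (y # p) \<and> {x, y} \<in> edges G \<and> path G y (y # p) v"
  by (auto simp: path_def)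

lemma path_memD: "path G u p v \<Longrightarrow> u \<in> set p \<and> v \<in> set p \<and> set p \<subseteq> verts G"
  by (auto simp: path_def)

lemma gdist_le: "path G u p v \<Longrightarrow> gdist G u v \<le> path_length G p"
  unfolding gdist_def by (rule INF_lower) simp

lemma gdist_self: "v \<in> verts G \<Longrightarrow> gdist G v v = 0"
  using gdist_le[of G v "[v]" v] by (simp add: path_def)

lemma gdist_attained:
  assumes "graph G" "gdist G u v \<noteq> \<infinity>"
  obtains p where "path G u p v" "path_length G p = gdist G u v"
proof -
  have "{p. path G u p v} \<subseteq> {p. set p \<subseteq> verts G \<and> distinct p}" by (auto simp: path_def)
  moreover have "finite {p. set p \<subseteq> verts G \<and> distinct p}"
    using assms by (intro finite_subset_distinct) (simp add: graph_def)
  ultimately have fin: "finite {p. path G u p v}" by (rule finite_subset)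
  have ne: "{p. path G u p v} \<noteq> {}"
  proof
    assume "{p. path G u p v} = {}"
    then show False using assms(2) by (simp add: gdist_def)
  qed
  have "gdist G u v \<in> path_length G ` {p. path G u p v}"
    unfolding gdist_def using fin ne by (simp add: cInf_eq_Min)
  then show ?thesis using that by auto
qed

text \<open>Paths are simple, so the edge can be prepended only if \<open>x\<close> is not yet on
  the path; otherwise the final segment starting at \<open>x\<close> is already short
  enough.\<close>

lemma gdist_step:
  assumes G: "graph G" and e: "{x, u} \<in> edges G"
  shows "gdist G x v \<le> weight G {x, u} + gdist G u v"
proof (cases "gdist G u v = \<infinity>")
  case False
  then obtain p where p: "path G u p v" "path_length G p = gdist G u v"
    using gdist_attained[OF G] by blast
  have x: "x \<in> verts G" using G e unfolding graph_def by blast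
  show ?thesis
  proof (cases "x \<in> set p")
    case True
    then obtain a b where ab: "p = a @ x # b" by (auto simp: in_set_conv_decomp)
    have "gdist G x v \<le> path_length G (x # b)" using path_split(2) p ab gdist_le by metis
    also have "\<dots> \<le> path_length G p" unfolding ab path_length_split[of G a x b] by simp
    also have "\<dots> \<le> weight G {x, u} + gdist G u v" using p by simp
    finally show ?thesis .
  next
    case False
    obtain q where q: "p = u # q" using p by (cases p) (auto simp: path_def)
    have "path G x (x # p) v" unfolding q path_Cons using p q e x False by auto
    then show ?thesis using gdist_le p q by fastforce
  qed
qed simp

lemma gdist_edge: "graph G \<Longrightarrow> {x, y} \<in> edges G \<Longrightarrow> gdist G x y \<le> weight G {x, y}"
  using gdist_step[of G x y y] gdist_self[of y G] by (auto simp: graph_def)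

lemma gdist_path_triangle:
  assumes "graph G" "path G u p v"
  shows "gdist G u w \<le> path_length G p + gdist G v w"
  using assms(2)
proof (induction p arbitrary: u rule: induct_list012)
  case (3 x y zs)
  then have p: "u = x" "{x, y} \<in> edges G" "path G y (y # zs) v" by (auto simp: path_Cons)
  have "gdist G u w \<le> weight G {x, y} + gdist G y w" using gdist_step[OF assms(1) p(2)] p(1) by simp
  also have "\<dots> \<le> weight G {x, y} + (path_length G (y # zs) + gdist G v w)"
    using "3.IH"(2)[OF p(3)] by (intro add_left_mono)
  finally show ?case by (simp add: add.assoc)
qed (auto simp: path_def)

lemma gdist_triangle:
  assumes "graph G"
  shows "gdist G u w \<le> gdist G u v + gdist G v w"
proof (cases "gdist G u v = \<infinity>")
  case False
  then obtain p where "path G u p v" "path_length G p = gdist G u v"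
    using gdist_attained[OF assms] by blast
  then show ?thesis using gdist_path_triangle[OF assms] by metis
qed simp

text \<open>The disjunct \<open>x = y\<close> secures reflexivity for elements outside the vertex
  set, where there is no path and \<open>gdist\<close> is infinite.\<close>

definition gdist_within :: "'a wgraph \<Rightarrow> real \<Rightarrow> 'a \<Rightarrow> 'a \<Rightarrow> bool" where
  "gdist_within G p x y \<longleftrightarrow> 0 \<le> p \<and> (x = y \<or> gdist G x y \<le> ennreal p)"

lemma closeness_gdist_within: "graph G \<Longrightarrow> closeness (gdist_within G)"
proof
  assume G: "graph G"
  fix p q x y z
  show "gdist_within G p x y \<Longrightarrow> 0 \<le> p" by (simp add: gdist_within_def)
  show "gdist_within G 0 x x" by (simp add: gdist_within_def)
  show "gdist_within G p x y \<Longrightarrow> gdist_within G p y x" by (auto simp: gdist_within_def gdist_commute)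
  show "gdist_within G q x y" if "gdist_within G p x y" "p \<le> q"
    using that order_trans[OF _ ennreal_leI[OF that(2)]] by (auto simp: gdist_within_def)
  show "gdist_within G (p + q) x z" if "gdist_within G p x y" "gdist_within G q y z"
  proof -
    have *: "gdist G x z \<le> ennreal p + ennreal q" if "gdist G x y \<le> ennreal p" "gdist G y z \<le> ennreal q"
      using gdist_triangle[OF G, of x z y] add_mono[OF that] by (rule order_trans)
    have "p \<le> p + q" "q \<le> p + q" using that by (auto simp: gdist_within_def)
    then have "ennreal p \<le> ennreal (p + q)" "ennreal q \<le> ennreal (p + q)" by (auto intro: ennreal_leI)
    then show ?thesis using that * by (auto simp: gdist_within_def ennreal_plus intro: order_trans)
  qed
qed

text \<open>A shortest path out of \<open>X\<close> uses an edge leaving \<open>X\<close>, whose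
  inner end lies in \<open>S\<close>; splitting the path there splits its length.\<close>

lemma separates_gdist_within:
  assumes G: "graph G"
    and cross: "\<And>a b. a \<in> X \<Longrightarrow> b \<notin> X \<Longrightarrow> {a, b} \<in> edges G \<Longrightarrow> a \<in> S"
  shows "separates (gdist_within G) S X (Y - X)"
  unfolding separates_def
proof (intro ballI allI impI)
  fix x y p assume x: "x \<in> X" and y: "y \<in> Y - X" and w: "gdist_within G p x y"
  have p0: "0 \<le> p" and g: "gdist G x y \<le> ennreal p" using w x y by (auto simp: gdist_within_def)
  then have "gdist G x y \<noteq> \<infinity>" by (auto simp: top_unique)
  then obtain P where P: "path G x P y" "path_length G P = gdist G x y" using gdist_attained[OF G] by blast
  have "\<exists>a z b. P = a @ z # b \<and> z \<in> S" if "path G x P y" "x \<in> X" "y \<notin> X" for x P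
    using that
  proof (induction P arbitrary: x rule: induct_list012)
    case (3 u v zs)
    then have e: "x = u" "{u, v} \<in> edges G" "path G v (v # zs) y" by (auto simp: path_Cons)
    show ?case
    proof (cases "v \<in> X")
      case True
      then obtain a z b where "v # zs = a @ z # b \<and> z \<in> S" using "3.IH"(2)[OF e(3)] 3 by blast
      then have "u # v # zs = (u # a) @ z # b \<and> z \<in> S" by simp
      then show ?thesis by blast
    next
      case False
      then have "u \<in> S" using cross e 3 by blast
      then show ?thesis by (intro exI[of _ "[]"]) auto
    qed
  qed (auto simp: path_def)
  then obtain a z b where z: "P = a @ z # b" "z \<in> S" using P x y by blast
  have "gdist G x z + gdist G z y \<le> path_length G P"
    using path_split[of G x a z b y] P z gdist_le path_length_split add_mono by metis
  then have le: "gdist G x z + gdist G z y \<le> ennreal p" using P g by simp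
  then have fin: "gdist G x z \<noteq> \<infinity>" "gdist G z y \<noteq> \<infinity>" by (auto simp: top_unique)
  define s t where "s = enn2real (gdist G x z)" and "t = enn2real (gdist G z y)"
  have st: "gdist G x z = ennreal s" "gdist G z y = ennreal t" "0 \<le> s" "0 \<le> t"
    using fin by (auto simp: s_def t_def less_top)
  have "s + t \<le> p" using le st p0 by (simp flip: ennreal_plus)
  then show "between (gdist_within G) S p x y"
    unfolding between_def gdist_within_def using z(2) st
    by (intro bexI[of _ z] exI[of _ s] exI[of _ t]) auto
qed

section \<open>Rooted tree-decompositions\<close>

lemma successively_crossing:
  assumes "successively R p" "p \<noteq> []" "hd p \<in> X" "last p \<notin> X"
  shows "\<exists>a\<in>set p \<inter> X. \<exists>b\<in>set p - X. R a b"
  using assms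
proof (induction p rule: induct_list012)
  case (3 x y zs)
  show ?case
  proof (cases "y \<in> X")
    case True
    then have "\<exists>a\<in>set (y # zs) \<inter> X. \<exists>b\<in>set (y # zs) - X. R a b" using 3 by (intro "3.IH"(2)) auto
    then show ?thesis by auto
  next
    case False
    then show ?thesis using 3 by auto
  qed
qed auto

lemma path_extend:
  "path G y p v \<Longrightarrow> x \<in> verts G \<Longrightarrow> x \<notin> set p \<Longrightarrow> {x, y} \<in> edges G \<Longrightarrow> path G x (x # p) v"
  by (cases p) (auto simp: path_def)

text \<open>\<open>rank\<close> only certifies that following \<open>par\<close> descends; it is not
  the depth. The last clause says that the tree has no edges within \<open>X\<close> besides those
  to parents.\<close>

definition rooting :: "('t, 'c) ugraph_scheme \<Rightarrow> 't \<Rightarrow> ('t \<Rightarrow> 't) \<Rightarrow> ('t \<Rightarrow> nat) \<Rightarrow> 't set \<Rightarrow> bool" where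
  "rooting T t0 par rank X \<longleftrightarrow> t0 \<in> X \<and> X \<subseteq> verts T \<and>
     (\<forall>u\<in>X - {t0}. par u \<in> X \<and> rank (par u) < rank u \<and> {u, par u} \<in> edges T) \<and>
     (\<forall>u\<in>X. \<forall>v\<in>X. {u, v} \<in> edges T \<longrightarrow> u \<noteq> t0 \<and> par u = v \<or> v \<noteq> t0 \<and> par v = u)"

text \<open>A set of nodes is enlarged one neighbour at a time; a second edge from the new node into the
  set would close a cycle.\<close>

lemma rooting_exists_card:
  assumes T: "is_tree T" and t0: "t0 \<in> verts T"
  shows "n < card (verts T) \<Longrightarrow> \<exists>X par rank. card X = Suc n \<and> rooting T t0 par rank X \<and>
    (\<forall>u\<in>X. rank u \<le> n) \<and> (\<forall>u\<in>X. \<forall>v\<in>X. \<exists>p. path T u p v \<and> set p \<subseteq> X)"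
proof (induction n)
  case 0
  have "{t0} \<notin> edges T" using T by (auto simp: is_tree_def graph_def)
  then have "rooting T t0 (\<lambda>_. t0) (\<lambda>_. 0) {t0}" using t0 by (simp add: rooting_def)
  moreover have "path T t0 [t0] t0" using t0 by (simp add: path_def)
  ultimately show ?case by (intro exI[of _ "{t0}"] exI[of _ "\<lambda>_. t0"] exI[of _ "\<lambda>_. 0"]) (auto intro!: exI[of _ "[t0]"])
next
  case (Suc n)
  then obtain X par rank where X: "card X = Suc n" "rooting T t0 par rank X" "\<forall>u\<in>X. rank u \<le> n"
    and con: "\<And>u v. u \<in> X \<Longrightarrow> v \<in> X \<Longrightarrow> \<exists>p. path T u p v \<and> set p \<subseteq> X" by auto
  have gT: "graph T" using T by (simp add: is_tree_def)
  then have finT: "finite (verts T)" by (simp add: graph_def)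
  have two: "e \<subseteq> verts T \<and> card e = 2" if "e \<in> edges T" for e
    using gT that unfolding graph_def by blast
  have Xs: "X \<subseteq> verts T" "t0 \<in> X" using X by (auto simp: rooting_def)
  have finX: "finite X" using Xs finT finite_subset by blast
  have "X \<noteq> verts T" using Suc X by auto
  then obtain w where w: "w \<in> verts T" "w \<notin> X" using Xs by blast
  obtain p where p: "path T t0 p w" using T t0 w unfolding is_tree_def by blast
  then obtain a u where a: "a \<in> X" "u \<in> set p" "u \<notin> X" "{a, u} \<in> edges T"
    using successively_crossing[of "\<lambda>x y. {x, y} \<in> edges T" p X] w Xs by (auto simp: path_def)
  have uT: "u \<in> verts T" using a two by blast
  have uniq: "q = a" if q: "q \<in> X" "{q, u} \<in> edges T" for q
  proof (rule ccontr)
    assume "q \<noteq> a"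
    obtain s where s: "path T q s a" "set s \<subseteq> X" using con[OF q(1) a(1)] by blast
    obtain s' where s': "s = q # s'" "s' \<noteq> []"
      using s(1) \<open>q \<noteq> a\<close> by (cases s) (auto simp: path_def split: if_splits)
    then obtain y s'' where s'': "s = q # y # s''" by (cases s') auto
    have "path T u (u # s) a"
      by (rule path_extend[OF s(1) uT]) (use s a q in \<open>auto simp: insert_commute\<close>)
    moreover have "last (u # s) = a" using s'' s(1) by (simp add: path_def)
    moreover have "3 \<le> length (u # s)" using s'' by simp
    ultimately have "cycle T (u # s)"
      unfolding cycle_def using a by simp
    then show False using T unfolding is_tree_def by blast
  qed
  have uu: "{u, u} \<notin> edges T" using two[of "{u, u}"] by auto
  have u_t0: "u \<noteq> t0" using a Xs by blast
  have old: "par x \<in> X \<and> rank (par x) < rank x \<and> {x, par x} \<in> edges T" if "x \<in> X" "x \<noteq> t0" for x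
    using X(2) that by (simp add: rooting_def)
  have old_edge: "x \<noteq> t0 \<and> par x = y \<or> y \<noteq> t0 \<and> par y = x" if "x \<in> X" "y \<in> X" "{x, y} \<in> edges T" for x y
    using X(2) that by (simp add: rooting_def)
  let ?X = "insert u X" and ?par = "par(u := a)" and ?rank = "rank(u := Suc n)"
  have "rooting T t0 ?par ?rank ?X"
    unfolding rooting_def
  proof (intro conjI ballI impI)
    fix x assume x: "x \<in> ?X - {t0}"
    show "?par x \<in> ?X" "?rank (?par x) < ?rank x" "{x, ?par x} \<in> edges T"
      by (cases "x = u"; use x a X(3) old[of x] in \<open>auto simp: insert_commute less_Suc_eq_le\<close>)+
  next
    fix x y assume xy: "x \<in> ?X" "y \<in> ?X" "{x, y} \<in> edges T"
    consider "x = u" "y = u" | "x = u" "y \<in> X" | "x \<in> X" "y = u" | "x \<in> X" "y \<in> X" using xy by blast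
    then show "x \<noteq> t0 \<and> ?par x = y \<or> y \<noteq> t0 \<and> ?par y = x"
    proof cases
      case 1 then show ?thesis using xy uu by simp
    next
      case 2 then show ?thesis using xy uniq[of y] u_t0 by (simp add: insert_commute)
    next
      case 3 then show ?thesis using xy uniq[of x] u_t0 by simp
    next
      case 4
      then have "x \<noteq> u" "y \<noteq> u" using a by auto
      with 4 show ?thesis using old_edge[of x y] xy by simp
    qed
  qed (use Xs uT in auto)
  moreover have "\<exists>p. path T x p y \<and> set p \<subseteq> ?X" if xy: "x \<in> ?X" "y \<in> ?X" for x y
  proof -
    have ext: "\<exists>p. path T u p y \<and> set p \<subseteq> ?X" if y: "y \<in> X" for y
    proof -
      obtain s where s: "path T a s y" "set s \<subseteq> X" using con[OF a(1) y] by blast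
      have "path T u (u # s) y"
        by (rule path_extend[OF s(1) uT]) (use s a in \<open>auto simp: insert_commute\<close>)
      then show ?thesis using s by (intro exI[of _ "u # s"]) auto
    qed
    show ?thesis
    proof (cases "x = u"; cases "y = u")
      assume "x = u" "y = u"
      then show ?thesis using uT by (intro exI[of _ "[u]"]) (auto simp: path_def)
    next
      assume "x \<noteq> u" "y = u"
      then obtain p where "path T u p x \<and> set p \<subseteq> ?X" using ext xy by blast
      then show ?thesis using path_rev \<open>y = u\<close> by (intro exI[of _ "rev p"]) auto
    next
      assume "x \<noteq> u" "y \<noteq> u"
      then show ?thesis using con[of x y] xy by auto
    qed (use ext xy in auto)
  qed
  moreover have "card ?X = Suc (Suc n)" using X finX a by simp
  moreover have "\<forall>x\<in>?X. ?rank x \<le> Suc n" using X(3) by auto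
  ultimately show ?case by blast
qed

lemma rooting_exists:
  assumes T: "is_tree T" and t0: "t0 \<in> verts T"
  shows "\<exists>par rank. rooting T t0 par rank (verts T)"
proof -
  have fin: "finite (verts T)" using T by (simp add: is_tree_def graph_def)
  then have "card (verts T) > 0" using t0 by (auto simp: card_gt_0_iff)
  then have "card (verts T) - 1 < card (verts T)" by simp
  from rooting_exists_card[OF T t0 this] obtain X par rank where
    X: "card X = card (verts T)" "rooting T t0 par rank X" using \<open>card (verts T) > 0\<close> by auto
  then have "X = verts T" using card_subset_eq[OF fin] unfolding rooting_def by blast
  with X show ?thesis by blast
qed

section \<open>Subtrees of a rooted tree-decomposition and their bags\<close>

locale rooted_decomposition =
  fixes G :: "'a wgraph" and T :: "nat ugraph" and B :: "nat \<Rightarrow> 'a set"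
    and t0 :: nat and par :: "nat \<Rightarrow> nat" and rank :: "nat \<Rightarrow> nat"
  assumes G: "graph G" and dec: "tree_decomposition G T B" and root: "rooting T t0 par rank (verts T)"
begin

definition below :: "nat \<Rightarrow> nat set" where
  "below t = {u. (u, t) \<in> {(u, par u) |u. u \<in> verts T - {t0}}\<^sup>*}"

definition under :: "nat \<Rightarrow> 'a set" where
  "under t = \<Union>(B ` below t)"

lemma t0: "t0 \<in> verts T"
  using root by (auto simp: rooting_def)

lemma par: "u \<in> verts T \<Longrightarrow> u \<noteq> t0 \<Longrightarrow> par u \<in> verts T \<and> rank (par u) < rank u \<and> {u, par u} \<in> edges T"
  using root by (auto simp: rooting_def)

lemma edgeD: "{u, v} \<in> edges T \<Longrightarrow> u \<in> verts T \<and> v \<in> verts T \<and> (u \<noteq> t0 \<and> par u = v \<or> v \<noteq> t0 \<and> par v = u)"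
proof -
  assume e: "{u, v} \<in> edges T"
  have "graph T" using dec by (auto simp: tree_decomposition_def is_tree_def)
  then have "{u, v} \<subseteq> verts T" using e unfolding graph_def by blast
  then show ?thesis using e root unfolding rooting_def by blast
qed

lemma below_self: "t \<in> below t"
  by (simp add: below_def)

lemma below_step: "u \<in> verts T \<Longrightarrow> u \<noteq> t0 \<Longrightarrow> par u \<in> below t \<Longrightarrow> u \<in> below t"
  unfolding below_def by (auto intro: converse_rtrancl_into_rtrancl)

lemma belowD: "u \<in> below t \<Longrightarrow> u \<noteq> t \<Longrightarrow> u \<in> verts T \<and> u \<noteq> t0 \<and> par u \<in> below t"
  unfolding below_def by (auto elim: converse_rtranclE)

lemma below_rank: "u \<in> below t \<Longrightarrow> u = t \<or> rank t < rank u"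
proof -
  assume "u \<in> below t"
  then have "(u, t) \<in> {(u, par u) |u. u \<in> verts T - {t0}}\<^sup>*" by (simp add: below_def)
  then show ?thesis
  proof (induction rule: converse_rtrancl_induct)
    case (step y z)
    then have "rank z < rank y" using par by auto
    then show ?case using step by auto
  qed simp
qed

lemma below_verts: "t \<in> verts T \<Longrightarrow> below t \<subseteq> verts T"
  using belowD by blast

lemma below_t0: "below t0 = verts T"
proof
  show "below t0 \<subseteq> verts T" using below_verts t0 by blast
  show "verts T \<subseteq> below t0"
  proof
    fix u assume "u \<in> verts T"
    then show "u \<in> below t0"
    proof (induction "rank u" arbitrary: u rule: less_induct)
      case less
      then show ?case using par[of u] below_step[of u t0] below_self[of t0] by (cases "u = t0") auto
    qed
  qed
qed

lemma below_edge:
  assumes "{u, v} \<in> edges T" "u \<in> below t" "v \<notin> below t"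
  shows "u = t \<and> t \<noteq> t0 \<and> v = par t"
  using edgeD[OF assms(1)] assms(2,3) below_step[of v t] belowD[of u t] by auto

lemma bag_crossing:
  assumes x: "x \<in> B u" "x \<in> B u'" and u: "u \<in> X" "u' \<notin> X" "u \<in> verts T" "u' \<in> verts T"
  shows "\<exists>a\<in>X. \<exists>b\<in>-X. {a, b} \<in> edges T \<and> x \<in> B a \<inter> B b"
proof -
  let ?I = "induced T {t \<in> verts T. x \<in> B t}"
  have "x \<in> verts G" using x u dec by (auto simp: tree_decomposition_def)
  then have "is_tree ?I" using dec by (simp add: tree_decomposition_def)
  moreover have "u \<in> verts ?I" "u' \<in> verts ?I" using x u by (auto simp: induced_def)
  ultimately obtain p where "path ?I u p u'" unfolding is_tree_def by blast
  then have "\<exists>a\<in>set p \<inter> X. \<exists>b\<in>set p - X. {a, b} \<in> edges ?I"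
    by (intro successively_crossing) (use u in \<open>auto simp: path_def\<close>)
  then show ?thesis by (auto simp: induced_def)
qed

text \<open>The nodes whose bags contain \<open>x\<close> are connected in the tree, and the only
  edge leaving \<open>below t\<close> joins \<open>t\<close> to its parent.\<close>

lemma below_crossing:
  assumes "x \<in> B u" "x \<in> B u'" "u \<in> below t" "u' \<notin> below t" "t \<in> verts T" "u' \<in> verts T"
  shows "t \<noteq> t0 \<and> x \<in> B t \<inter> B (par t)"
proof -
  have "u \<in> verts T" using assms below_verts by blast
  then obtain a b where "a \<in> below t" "b \<notin> below t" "{a, b} \<in> edges T" "x \<in> B a \<inter> B b"
    using bag_crossing[OF assms(1-4) _ assms(6)] by blast
  then show ?thesis using below_edge[of a b t] by auto
qed

lemma bag_sub: "t \<in> verts T \<Longrightarrow> B t \<subseteq> verts G"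
  using dec by (auto simp: tree_decomposition_def)

lemma edge_bag: "{a, b} \<in> edges G \<Longrightarrow> \<exists>t\<in>verts T. a \<in> B t \<and> b \<in> B t"
proof -
  assume "{a, b} \<in> edges G"
  moreover have "\<forall>e\<in>edges G. \<exists>t\<in>verts T. e \<subseteq> B t" using dec by (simp add: tree_decomposition_def)
  ultimately show ?thesis by blast
qed

lemma in_bag: "v \<in> verts G \<Longrightarrow> \<exists>t\<in>verts T. v \<in> B t"
proof -
  assume "v \<in> verts G"
  then have "is_tree (induced T {t \<in> verts T. v \<in> B t})" using dec by (simp add: tree_decomposition_def)
  then have "verts (induced T {t \<in> verts T. v \<in> B t}) \<noteq> {}" by (simp add: is_tree_def)
  then show ?thesis by (auto simp: induced_def)
qed

lemma under_t0: "under t0 = verts G"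
  unfolding under_def below_t0 using in_bag bag_sub by blast

text \<open>An edge of \<open>G\<close> leaving \<open>under c\<close> lies in a bag outside the
  subtree, so its inner end is in bags on both sides and hence in the adhesion set.\<close>

lemma separates_under:
  assumes c: "c \<in> verts T" "c \<noteq> t0"
  shows "separates (gdist_within G) (B (par c) \<inter> B c) (under c) (Y - under c)"
proof (rule separates_gdist_within[OF G])
  fix a b assume ab: "a \<in> under c" "b \<notin> under c" "{a, b} \<in> edges G"
  then obtain u where u: "u \<in> below c" "a \<in> B u" by (auto simp: under_def)
  obtain s where s: "s \<in> verts T" "a \<in> B s" "b \<in> B s" using edge_bag[OF ab(3)] by blast
  have "s \<notin> below c" using ab s by (auto simp: under_def)
  then show "a \<in> B (par c) \<inter> B c" using below_crossing[OF u(2) s(2) u(1)] s c by blast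
qed

lemma below_children: "t \<in> verts T \<Longrightarrow> below t = insert t (\<Union>c\<in>{c \<in> verts T - {t0}. par c = t}. below c)"
proof -
  assume t: "t \<in> verts T"
  have "u = t \<or> (\<exists>c\<in>verts T - {t0}. par c = t \<and> u \<in> below c)" if "u \<in> below t" for u
  proof (cases "u = t")
    case False
    have "(u, t) \<in> {(u, par u) |u. u \<in> verts T - {t0}}\<^sup>*" using that by (simp add: below_def)
    then obtain c where "(u, c) \<in> {(u, par u) |u. u \<in> verts T - {t0}}\<^sup>*" "c \<in> verts T - {t0}" "par c = t"
      using False by (auto elim: rtranclE)
    then show ?thesis by (auto simp: below_def)
  qed simp
  moreover have "below c \<subseteq> below t" if "c \<in> verts T - {t0}" "par c = t" for c
    using that unfolding below_def by (auto intro: rtrancl_into_rtrancl)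
  ultimately show ?thesis using below_self[of t] by blast
qed

lemma below_disjoint:
  assumes c: "c \<in> verts T - {t0}" "c' \<in> verts T - {t0}" "par c = par c'" "c \<noteq> c'"
  shows "below c \<inter> below c' = {}"
proof (rule ccontr)
  let ?P = "{(u, par u) |u. u \<in> verts T - {t0}}"
  assume "below c \<inter> below c' \<noteq> {}"
  then obtain u where "(u, c) \<in> ?P\<^sup>*" "(u, c') \<in> ?P\<^sup>*" by (auto simp: below_def)
  \<comment> \<open>Ancestors of \<open>u\<close> form a single line, so one of the two siblings
    would be an ancestor of the other, against the ranks.\<close>
  moreover have "single_valued ?P" by (auto simp: single_valued_def)
  ultimately have "(c, c') \<in> ?P\<^sup>* \<or> (c', c) \<in> ?P\<^sup>*" 
    using single_valued_confluent[of ?P u c c'] by blast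
  then have "c \<in> below c' \<or> c' \<in> below c" by (simp add: below_def)
  then have "par c \<in> below c' \<or> par c' \<in> below c" using belowD c(4) by metis
  then show False
  proof
    assume "par c \<in> below c'"
    then show False using below_rank[of "par c" c'] par[of c'] c by auto
  next
    assume "par c' \<in> below c"
    then show False using below_rank[of "par c'" c] par[of c] c by auto
  qed
qed

lemma td_under:
  assumes Pc: "\<And>t. t \<in> verts T \<Longrightarrow> Pc (B t)"
    and A: "\<And>t t'. {t, t'} \<in> edges T \<Longrightarrow> A (B t \<inter> B t')"
    and t: "t \<in> verts T"
  shows "td (gdist_within G) Pc A (under t) (B t)"
proof -
  \<comment> \<open>Ranks increase away from the root, so \<open>M - rank t\<close> decreases from a
    node to its children.\<close>
  define M where "M = Max (rank ` verts T)"
  have fin: "finite (verts T)" using dec by (auto simp: tree_decomposition_def is_tree_def graph_def)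
  have M: "rank u \<le> M" if "u \<in> verts T" for u using that fin by (simp add: M_def)
  show ?thesis using t
  proof (induction "M - rank t" arbitrary: t rule: less_induct)
    case less
    let ?ch = "{c \<in> verts T - {t0}. par c = t}"
    let ?C = "(\<lambda>c. (under c, B c)) ` ?ch"
    have disj: "under c \<inter> under c' \<subseteq> B t" if cc: "c \<in> ?ch" "c' \<in> ?ch" "c \<noteq> c'" for c c'
    proof
      fix x assume "x \<in> under c \<inter> under c'"
      then obtain u u' where u: "u \<in> below c" "x \<in> B u" "u' \<in> below c'" "x \<in> B u'" by (auto simp: under_def)
      have "u' \<notin> below c" using below_disjoint[of c c'] cc u by auto
      then show "x \<in> B t" using below_crossing[OF u(2,4,1)] cc u below_verts[of c'] by auto
    qed
    show ?case
    proof (rule td.node[of Pc, OF Pc[OF less.prems]])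
      show "under t = B t \<union> \<Union>(fst ` ?C)"
        unfolding under_def below_children[OF less.prems] by (auto simp: image_image)
    next
      fix V' B' assume "(V', B') \<in> ?C"
      then obtain c where c: "c \<in> verts T" "c \<noteq> t0" "par c = t" "V' = under c" "B' = B c" by auto
      have "rank t < rank c" using par[OF c(1,2)] c by simp
      then have "M - rank c < M - rank t" using M[OF c(1)] by linarith
      then show "td (gdist_within G) Pc A V' B'" using less.hyps c by blast
      have "{t, c} \<in> edges T" using par[OF c(1,2)] c by (simp add: insert_commute)
      moreover have "t \<notin> below c" using below_rank[of t c] \<open>rank t < rank c\<close> by auto
      then have "under c \<inter> B t \<subseteq> B c"
        using below_crossing[of _ _ t c] c less.prems unfolding under_def by blast
      ultimately show "A (B t \<inter> B') \<and> V' \<inter> B t \<subseteq> B' \<and> separates (gdist_within G) (B t \<inter> B') V' (under t - V')"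
        using A separates_under[OF c(1,2)] c by auto
    next
      fix h h' assume h: "h \<in> ?C" "h' \<in> ?C" "h \<noteq> h'"
      obtain c where c: "c \<in> ?ch" "h = (under c, B c)" using h(1) by blast
      obtain c' where c': "c' \<in> ?ch" "h' = (under c', B c')" using h(2) by blast
      have "c \<noteq> c'" using c c' h(3) by blast
      then show "fst h \<inter> fst h' \<subseteq> B t" using disj[OF c(1) c'(1)] c c' by simp
    qed
  qed
qed

text \<open>\<open>X\<close> is the component of the tree without \<open>t\<close> that contains
  \<open>s\<close>, or a union of components: the subtree of a child of \<open>t\<close>, or
  everything not below \<open>t\<close>. Vertices shared across it lie in the adhesion set towards
  \<open>t'\<close>.\<close>

lemma sides:
  assumes t: "t \<in> verts T" and s: "s \<in> verts T" "s \<noteq> t"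
  shows "\<exists>t' X. {t, t'} \<in> edges T \<and> s \<in> X \<and> t \<notin> X \<and>
    (\<forall>x u u'. u \<in> X \<longrightarrow> u' \<in> verts T - X \<longrightarrow> x \<in> B u \<inter> B u' \<longrightarrow> x \<in> B t \<inter> B t')"
proof (cases "s \<in> below t")
  case True
  then obtain c where c: "c \<in> verts T" "c \<noteq> t0" "par c = t" "s \<in> below c"
    using below_children[OF t] s by auto
  have "t \<notin> below c" using below_rank[of t c] par[OF c(1,2)] c by auto
  moreover have "{t, c} \<in> edges T" using par[OF c(1,2)] c by (simp add: insert_commute)
  ultimately show ?thesis
    using c below_crossing[of _ _ _ c] by (intro exI[of _ c] exI[of _ "below c"]) blast
next
  case False
  then have "t \<noteq> t0" using below_t0 s by auto
  then have "{t, par t} \<in> edges T" using par[OF t] by simp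
  moreover have "x \<in> B t \<inter> B (par t)" if "u \<in> verts T - below t" "u' \<in> below t" "x \<in> B u \<inter> B u'" for u u' x
    using below_crossing[of x u' u t] that t by auto
  ultimately show ?thesis using False s below_self[of t]
    by (intro exI[of _ "par t"] exI[of _ "verts T - below t"]) auto
qed

end

section \<open>Distances in torsos\<close>

context rooted_decomposition
begin

lemma graph_torso: "t \<in> verts T \<Longrightarrow> graph (weighted_torso G T B t)"
proof -
  assume t: "t \<in> verts T"
  have "finite (B t)" using bag_sub[OF t] G finite_subset by (auto simp: graph_def)
  moreover have "e \<subseteq> B t \<and> card e = 2" if "e \<in> edges (torso G T B t)" for e
  proof -
    have "e \<in> edges (induced G (B t)) \<or> (\<exists>u v. e = {u, v} \<and> u \<noteq> v \<and> u \<in> B t \<and> v \<in> B t)"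
      using that unfolding torso_def by auto
    then show ?thesis
    proof
      assume "e \<in> edges (induced G (B t))"
      then show ?thesis using G unfolding graph_def induced_def by simp
    qed (auto simp: card_insert_if)
  qed
  ultimately show ?thesis by (simp add: graph_def weighted_torso_def torso_def)
qed

lemma verts_torso: "verts (weighted_torso G T B t) = B t"
  by (simp add: weighted_torso_def torso_def)

lemma edges_torso: "edges (weighted_torso G T B t) = edges (torso G T B t)"
  by (simp add: weighted_torso_def)

text \<open>Every torso edge is weighted by the distance of its ends in \<open>G\<close>, so the
  triangle inequality applies along a torso path.\<close>

lemma gdist_le_torso: "gdist G u v \<le> gdist (weighted_torso G T B t) u v" if t: "t \<in> verts T"
proof (cases "gdist (weighted_torso G T B t) u v = \<infinity>")
  case False
  then obtain p where p: "path (weighted_torso G T B t) u p v"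
      "path_length (weighted_torso G T B t) p = gdist (weighted_torso G T B t) u v"
    using gdist_attained[OF graph_torso[OF t]] by blast
  have "gdist G u v \<le> path_length (weighted_torso G T B t) p"
    using p(1)
  proof (induction p arbitrary: u rule: induct_list012)
    case (2 x)
    then have "u \<in> B t" "u = v" by (auto simp: path_def verts_torso)
    then show ?case using gdist_self bag_sub[OF t] by fastforce
  next
    case (3 x y zs)
    then have e: "u = x" "{x, y} \<in> edges (torso G T B t)" "path (weighted_torso G T B t) y (y # zs) v"
      by (auto simp: path_Cons edges_torso)
    have "gdist G u v \<le> gdist G x y + gdist G y v" using gdist_triangle[OF G] e(1) by simp
    also have "\<dots> \<le> weight (weighted_torso G T B t) {x, y} + path_length (weighted_torso G T B t) (y # zs)"
      using "3.IH"(2)[OF e(3)] weight_weighted_torso[OF e(2)] by (intro add_mono) auto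
    finally show ?case by simp
  qed (simp add: path_def)
  with p show ?thesis by simp
qed simp

lemma gdist_torso_edge:
  assumes t: "t \<in> verts T" and t': "{t, t'} \<in> edges T" and uw: "u \<in> B t \<inter> B t'" "w \<in> B t \<inter> B t'"
  shows "gdist (weighted_torso G T B t) u w \<le> gdist G u w"
proof (cases "u = w")
  case True
  then show ?thesis using gdist_self[of w "weighted_torso G T B t"] uw by (simp add: verts_torso)
next
  case False
  then have "{u, w} \<in> edges (torso G T B t)" using t' uw unfolding torso_def by auto
  then show ?thesis
    using gdist_edge[OF graph_torso[OF t], of u w] weight_weighted_torso[of u w G T B t]
    by (simp add: edges_torso)
qed

text \<open>The second conjunct handles a path that starts outside the bag: it can re-enter the bag only
  through the adhesion set towards its side of the tree.\<close>

lemma torso_dist_aux: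
  assumes t: "t \<in> verts T" and v: "v \<in> B t" and p: "path G x p v"
  shows "(x \<in> B t \<longrightarrow> gdist (weighted_torso G T B t) x v \<le> path_length G p) \<and>
    (x \<notin> B t \<longrightarrow> (\<forall>t' X. {t, t'} \<in> edges T \<longrightarrow> t \<notin> X \<longrightarrow> (\<exists>s\<in>X \<inter> verts T. x \<in> B s) \<longrightarrow>
      (\<forall>x u u'. u \<in> X \<longrightarrow> u' \<in> verts T - X \<longrightarrow> x \<in> B u \<inter> B u' \<longrightarrow> x \<in> B t \<inter> B t') \<longrightarrow>
      (\<exists>w\<in>B t \<inter> B t'. gdist G x w + gdist (weighted_torso G T B t) w v \<le> path_length G p)))"
    (is "?P x p \<and> ?Q x p")
  using p
proof (induction p arbitrary: x rule: induct_list012)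
  case 1 then show ?case by (simp add: path_def)
next
  case (2 y)
  then have "x = v" by (auto simp: path_def)
  then show ?case using v gdist_self[of v "weighted_torso G T B t"] by (simp add: verts_torso)
next
  case (3 x' y zs)
  let ?H = "weighted_torso G T B t"
  have e: "x' = x" "{x, y} \<in> edges G" "path G y (y # zs) v" using "3.prems" by (auto simp: path_Cons)
  have IH: "?P y (y # zs)" "?Q y (y # zs)" using "3.IH"(2)[OF e(3)] by auto
  have len: "path_length G (x' # y # zs) = weight G {x, y} + path_length G (y # zs)" using e by simp
  have gxy: "gdist G x y \<le> weight G {x, y}" using gdist_edge[OF G e(2)] .
  obtain s' where s': "s' \<in> verts T" "x \<in> B s'" "y \<in> B s'" using edge_bag[OF e(2)] by blast
  have via: "gdist G x w + d \<le> path_length G (x' # y # zs)" if "gdist G y w + d \<le> path_length G (y # zs)" for w d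
  proof -
    have "gdist G x w + d \<le> (gdist G x y + gdist G y w) + d"
      using gdist_triangle[OF G] by (intro add_right_mono)
    also have "\<dots> = gdist G x y + (gdist G y w + d)" by (simp add: add.assoc)
    also have "\<dots> \<le> path_length G (x' # y # zs)" unfolding len using gxy that by (intro add_mono)
    finally show ?thesis .
  qed
  have "?P x (x' # y # zs)"
  proof
    assume x: "x \<in> B t"
    show "gdist ?H x v \<le> path_length G (x' # y # zs)"
    proof (cases "y \<in> B t")
      case True
      have edge: "{x, y} \<in> edges (torso G T B t)" using e x True unfolding torso_def induced_def by auto
      have "gdist ?H x v \<le> weight ?H {x, y} + gdist ?H y v"
        using gdist_step[OF graph_torso[OF t]] edge by (simp add: edges_torso)
      also have "\<dots> \<le> path_length G (x' # y # zs)"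
        unfolding len weight_weighted_torso[OF edge] using gxy IH(1) True by (intro add_mono) auto
      finally show ?thesis .
    next
      case False
      then have "s' \<noteq> t" using s' by auto
      \<comment> \<open>The path leaves the bag at \<open>x\<close> and returns at some
        \<open>w\<close> of the same adhesion set; the whole detour is replaced by the torso edge
        between \<open>x\<close> and \<open>w\<close>.\<close>
      from sides[OF t s'(1) this] obtain t' X where X: "{t, t'} \<in> edges T" "s' \<in> X" "t \<notin> X"
        "\<forall>x u u'. u \<in> X \<longrightarrow> u' \<in> verts T - X \<longrightarrow> x \<in> B u \<inter> B u' \<longrightarrow> x \<in> B t \<inter> B t'" by blast
      have xt': "x \<in> B t \<inter> B t'" using X(4)[rule_format, of s' t x] X s' t x by blast
      have "\<exists>s\<in>X \<inter> verts T. y \<in> B s" using X(2) s' by blast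
      then obtain w where w: "w \<in> B t \<inter> B t'" "gdist G y w + gdist ?H w v \<le> path_length G (y # zs)"
        using IH(2)[rule_format, OF False X(1,3)] X(4) by blast
      have "gdist ?H x v \<le> gdist ?H x w + gdist ?H w v" using gdist_triangle[OF graph_torso[OF t]] .
      also have "\<dots> \<le> gdist G x w + gdist ?H w v"
        using gdist_torso_edge[OF t X(1) xt' w(1)] by (intro add_right_mono)
      also have "\<dots> \<le> path_length G (x' # y # zs)" using via[OF w(2)] .
      finally show ?thesis .
    qed
  qed
  moreover have "?Q x (x' # y # zs)"
  proof (intro impI allI)
    fix t' X
    assume x: "x \<notin> B t" and X: "{t, t'} \<in> edges T" "t \<notin> X" "\<exists>s\<in>X \<inter> verts T. x \<in> B s"
      and cross: "\<forall>x u u'. u \<in> X \<longrightarrow> u' \<in> verts T - X \<longrightarrow> x \<in> B u \<inter> B u' \<longrightarrow> x \<in> B t \<inter> B t'"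
    \<comment> \<open>All bags of \<open>x\<close> lie in \<open>X\<close>, since otherwise
      \<open>x\<close> would belong to the adhesion set and so to \<open>B t\<close>; in particular
      the bag of the next edge does.\<close>
    have s'X: "s' \<in> X"
    proof (rule ccontr)
      assume "s' \<notin> X"
      then have "x \<in> B t" using X(3) cross s' by blast
      with x show False by simp
    qed
    show "\<exists>w\<in>B t \<inter> B t'. gdist G x w + gdist ?H w v \<le> path_length G (x' # y # zs)"
    proof (cases "y \<in> B t")
      case True
      have "y \<in> B t \<inter> B t'" using cross[rule_format, of s' t y] s'X X s' t True by blast
      moreover have "gdist G x y + gdist ?H y v \<le> path_length G (x' # y # zs)"
        unfolding len using gxy IH(1) True by (intro add_mono) auto
      ultimately show ?thesis by blast
    next
      case False
      have "\<exists>s\<in>X \<inter> verts T. y \<in> B s" using s'X s' by blast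
      then obtain w where "w \<in> B t \<inter> B t'" "gdist G y w + gdist ?H w v \<le> path_length G (y # zs)"
        using IH(2)[rule_format, OF False X(1,2)] cross by blast
      then show ?thesis using via by blast
    qed
  qed
  ultimately show ?case by blast
qed

lemma gdist_torso:
  assumes t: "t \<in> verts T" and "u \<in> B t" "v \<in> B t"
  shows "gdist (weighted_torso G T B t) u v = gdist G u v"
proof (rule antisym)
  show "gdist (weighted_torso G T B t) u v \<le> gdist G u v"
  proof (cases "gdist G u v = \<infinity>")
    case False
    then obtain p where p: "path G u p v" "path_length G p = gdist G u v" using gdist_attained[OF G] by blast
    then show ?thesis using torso_dist_aux[OF t assms(3) p(1)] assms(2) by simp
  qed simp
qed (rule gdist_le_torso[OF t])

end

section \<open>Passing to the Assouad--Nagata dimension\<close>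

lemma r_path_of_chain:
  assumes "chain (gdist_within G) X c r x y" "x \<in> X"
  shows "\<exists>p. p \<noteq> [] \<and> hd p = x \<and> last p = y \<and> set p \<subseteq> X \<and> (\<forall>z\<in>set p. c z = c x) \<and>
    successively (gdist_within G r) p"
  using assms(1)
proof (induction rule: chain_induct)
  case refl
  then show ?case using assms(2) by (intro exI[of _ "[x]"]) simp
next
  case (step u v)
  then obtain p where p: "p \<noteq> []" "hd p = x" "last p = u" "set p \<subseteq> X" "\<forall>z\<in>set p. c z = c x"
    "successively (gdist_within G r) p" by blast
  have "c v = c x" using p step by (metis last_in_set)
  then show ?case using p step by (intro exI[of _ "p @ [v]"]) (auto simp: successively_append_iff)
qed

lemma chain_of_list:
  assumes "successively (gdist_within G r) p" "p \<noteq> []" "set p \<subseteq> X" "\<forall>x\<in>set p. \<forall>y\<in>set p. c x = c y" "y \<in> set p"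
  shows "chain (gdist_within G) X c r (hd p) y"
  using assms
proof (induction p arbitrary: y rule: rev_induct)
  case (snoc z p)
  show ?case
  proof (cases "p = []")
    case True then show ?thesis using snoc chain_refl by (auto intro: chain_refl)
  next
    case False
    have IH: "chain (gdist_within G) X c r (hd p) y'" if "y' \<in> set p" for y'
    proof (rule snoc.IH[OF _ False _ _ that])
      show "successively (gdist_within G r) p" using snoc.prems(1) by (simp add: successively_append_iff)
      show "set p \<subseteq> X" using snoc.prems(3) by simp
      show "\<forall>x\<in>set p. \<forall>y\<in>set p. c x = c y"
        using snoc.prems(4) unfolding set_append by blast
    qed
    show ?thesis
    proof (cases "y \<in> set p")
      case True then show ?thesis using IH False by simp
    next
      case yz: False
      then have "y = z" using snoc by simp
      moreover have "chain (gdist_within G) X c r (hd p) z"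
      proof (rule chain_step[OF IH[OF last_in_set[OF False]]])
        have l: "last p \<in> set p" using False by simp
        then show "last p \<in> X" "z \<in> X" using snoc.prems(3) by auto
        have "last p \<in> set (p @ [z])" "z \<in> set (p @ [z])" using l by auto
        then show "c (last p) = c z" using snoc.prems(4) by blast
        show "gdist_within G r (last p) z" using snoc.prems(1) False by (simp add: successively_append_iff)
      qed
      ultimately show ?thesis using False by simp
    qed
  qed
qed simp

text \<open>Distances in the weighted torso are those of \<open>G\<close>, so a colouring of the
  torso serves the bag in the metric of \<open>G\<close>. The surplus of \<open>n\<close> over
  \<open>m\<close> leaves room for a second colour when the torsos need only one.\<close>

lemma controlled_torso:
  assumes "rooted_decomposition G T B t0 par rank" and t: "t \<in> verts T"
    and col: "\<And>r. r > 0 \<Longrightarrow> \<exists>c. colouring m r (f r) (weighted_torso G T B t) c"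
    and f: "\<And>r. r > 0 \<Longrightarrow> f r \<le> K * r" and K: "0 < K" and mn: "m \<le> n"
  shows "controlled (gdist_within G) (gdist_within G) n K (B t)"
  unfolding controlled_def
proof (intro allI impI)
  interpret rooted_decomposition G T B t0 par rank by fact
  let ?H = "weighted_torso G T B t"
  fix r :: real assume r: "r > 0"
  then obtain c where c: "colouring m r (f r) ?H c" using col by blast
  have Kr: "0 \<le> K * r" using K r by simp
  have "gdist_within G (K * r) x y" if ch: "chain (gdist_within G) (B t) c r x y" for x y
  proof (cases "x = y")
    case True then show ?thesis using Kr by (simp add: gdist_within_def)
  next
    case False
    then have xy: "x \<in> B t" "y \<in> B t" using chain_mem[OF ch] by auto
    obtain p where p: "p \<noteq> []" "hd p = x" "last p = y" "set p \<subseteq> B t" "\<forall>z\<in>set p. c z = c x"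
      "successively (gdist_within G r) p" using r_path_of_chain[OF ch xy(1)] by blast
    have "successively (\<lambda>x y. gdist ?H x y \<le> ennreal r) p"
    proof (rule successively_mono[OF p(6)])
      fix u v assume "u \<in> set p" "v \<in> set p" "gdist_within G r u v"
      moreover have "u \<in> B t" "v \<in> B t" using calculation p(4) by auto
      ultimately show "gdist ?H u v \<le> ennreal r"
        using gdist_torso[OF t, of u v] gdist_self[of u ?H] by (auto simp: gdist_within_def verts_torso)
    qed
    then have "r_path ?H r p" using p by (simp add: r_path_def verts_torso)
    moreover have "\<forall>x\<in>set p. \<forall>y\<in>set p. c x = c y"
    proof (intro ballI)
      fix a b assume "a \<in> set p" "b \<in> set p"
      then show "c a = c b" using bspec[OF p(5), of a] bspec[OF p(5), of b] by simp
    qed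
    ultimately have "wdiam ?H (set p) \<le> ennreal (f r)" using c unfolding colouring_def by blast
    moreover have "x \<in> set p" "y \<in> set p" using p by auto
    then have "gdist ?H x y \<le> wdiam ?H (set p)"
      unfolding wdiam_def by (intro SUP_upper2[of x] SUP_upper2[of y]) auto
    ultimately have "gdist G x y \<le> ennreal (f r)" using gdist_torso[OF t xy] by simp
    also have "\<dots> \<le> ennreal (K * r)" using f[OF r] by (rule ennreal_leI)
    finally show ?thesis using Kr by (simp add: gdist_within_def)
  qed
  moreover have "\<forall>x\<in>B t. c x < n"
  proof
    fix x assume "x \<in> B t"
    then have "c x < m" using c unfolding colouring_def verts_torso by blast
    then show "c x < n" using mn by simp
  qed
  ultimately show "\<exists>c. (\<forall>x\<in>B t. c x < n) \<and> (\<forall>x y. chain (gdist_within G) (B t) c r x y \<longrightarrow> gdist_within G (K * r) x y)"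
    by blast
qed

lemma colouring_of_controlled:
  assumes G: "graph G" and con: "controlled (gdist_within G) (gdist_within G) m K (verts G)" and r: "r > 0"
  shows "\<exists>c. colouring m r (K * r) G c"
proof -
  interpret closeness "gdist_within G" using closeness_gdist_within[OF G] .
  obtain c where c: "\<forall>x\<in>verts G. c x < m"
      "\<And>x y. chain (gdist_within G) (verts G) c r x y \<Longrightarrow> gdist_within G (K * r) x y"
    using con r unfolding controlled_def by blast
  have "wdiam G (set p) \<le> ennreal (K * r)" if p: "r_path G r p" "\<forall>x\<in>set p. \<forall>y\<in>set p. c x = c y" for p
    unfolding wdiam_def
  proof (intro SUP_least)
    fix x y assume xy: "x \<in> set p" "y \<in> set p"
    have sc: "successively (gdist_within G r) p"
      using p(1) r unfolding r_path_def by (auto intro: successively_mono simp: gdist_within_def)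
    have "p \<noteq> []" "set p \<subseteq> verts G" using p by (auto simp: r_path_def)
    then have "chain (gdist_within G) (verts G) c r (hd p) x" "chain (gdist_within G) (verts G) c r (hd p) y"
      using chain_of_list[OF sc _ _ p(2)] xy by auto
    then have "chain (gdist_within G) (verts G) c r x y" using chain_sym chain_trans by metis
    then have "gdist_within G (K * r) x y" using c by blast
    then show "gdist G x y \<le> ennreal (K * r)"
      using gdist_self[of x G] xy \<open>set p \<subseteq> verts G\<close> by (auto simp: gdist_within_def)
  qed
  moreover have "c \<in> verts G \<rightarrow> {..<m}" using c(1) by auto
  ultimately show ?thesis unfolding colouring_def by blast
qed

lemma construction_controlled:
  assumes G: "graph G" and con: "construction k \<H> G T B"
    and f: "control_function n f \<H>" "\<And>r. r > 0 \<Longrightarrow> f r \<le> K0 * r" and K0: "0 < K0" and nm: "n + 1 \<le> m"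
    and K: "\<And>D V B. two_closeness D (gdist_within G) \<Longrightarrow>
      td D (controlled D (gdist_within G) m K0) (\<lambda>S. finite S \<and> card S < Suc k) V B \<Longrightarrow>
      controlled D (gdist_within G) m K V"
  shows "controlled (gdist_within G) (gdist_within G) m K (verts G)"
proof -
  have dec: "tree_decomposition G T B" and tree: "is_tree T" and adh: "adhesion T B \<le> k"
    and H: "\<And>t. t \<in> verts T \<Longrightarrow> weighted_torso G T B t \<in> \<H>"
    using con by (auto simp: construction_def tree_decomposition_def)
  obtain t0 where t0: "t0 \<in> verts T" using tree by (auto simp: is_tree_def)
  obtain par rank where "rooting T t0 par rank (verts T)" using rooting_exists[OF tree t0] by blast
  then have rd: "rooted_decomposition G T B t0 par rank"
    using G dec by unfold_locales
  interpret rooted_decomposition G T B t0 par rank by (rule rd)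
  interpret closeness "gdist_within G" using closeness_gdist_within[OF G] .
  have two: "two_closeness (gdist_within G) (gdist_within G)" by unfold_locales auto
  \<comment> \<open>Adhesion at most \<open>k\<close> becomes the strict bound \<open>Suc k\<close>
    used in the induction.\<close>
  have "td (gdist_within G) (controlled (gdist_within G) (gdist_within G) m K0) (\<lambda>S. finite S \<and> card S < Suc k) (under t0) (B t0)"
  proof (rule td_under[OF _ _ t0])
    fix t assume t: "t \<in> verts T"
    show "controlled (gdist_within G) (gdist_within G) m K0 (B t)"
      by (rule controlled_torso[OF rd t _ f(2) K0 nm]) (use f(1) H[OF t] in \<open>auto simp: control_function_def\<close>)
  next
    fix t t' assume e: "{t, t'} \<in> edges T"
    have "finite (verts T)" using tree by (simp add: is_tree_def graph_def)
    moreover have "{card (B t \<inter> B t') | t t'. {t, t'} \<in> edges T} \<subseteq>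
        (\<lambda>(t, t'). card (B t \<inter> B t')) ` (verts T \<times> verts T)"
      using edgeD by fastforce
    ultimately have "finite {card (B t \<inter> B t') | t t'. {t, t'} \<in> edges T}"
      using finite_subset by blast
    then have "card (B t \<inter> B t') \<le> adhesion T B"
      unfolding adhesion_def using e by (intro Max_ge) auto
    moreover have "finite (B t)" using bag_sub[of t] edgeD[OF e] G finite_subset by (auto simp: graph_def)
    ultimately show "finite (B t \<inter> B t') \<and> card (B t \<inter> B t') < Suc k" using adh by auto
  qed
  then show ?thesis using K[OF two] unfolding under_t0 by blast
qed

lemma ANdim_le:
  assumes "control_function n f \<C>" "dilation f"
  shows "ANdim \<C> \<le> enat n"
proof -
  have "n \<in> {n. \<exists>f. control_function n f \<C> \<and> dilation f}" using assms by blast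
  then show ?thesis unfolding ANdim_def by (rule INF_lower)
qed

lemma ANdim_attained:
  assumes "ANdim \<C> \<noteq> \<infinity>"
  obtains n f where "ANdim \<C> = enat n" "control_function n f \<C>" "dilation f"
proof -
  let ?N = "{n. \<exists>f. control_function n f \<C> \<and> dilation f}"
  have "?N \<noteq> {}"
  proof
    assume "?N = {}"
    then have "ANdim \<C> = \<infinity>" unfolding ANdim_def by (simp only: image_empty Inf_enat_def) simp
    with assms show False by simp
  qed
  then obtain n where "enat n \<in> enat ` ?N" by blast
  then have "ANdim \<C> \<in> enat ` ?N" unfolding ANdim_def by (rule wellorder_InfI)
  then obtain n where "n \<in> ?N" "ANdim \<C> = enat n" by (rule imageE)
  then show ?thesis using that by blast
qed

theorem theorem11:
  fixes k :: nat and \<H> \<G> :: "'a wgraph set"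
  assumes "\<forall>H\<in>\<H>. weighted_graph H"
    and "\<forall>G\<in>\<G>. weighted_graph G"
    and "\<forall>G\<in>\<G>. constructable k \<H> G"
  shows "ANdim \<G> \<le> max (ANdim \<H>) 1"
proof (cases "ANdim \<H> = \<infinity>")
  case False
  then obtain n f where n: "ANdim \<H> = enat n" and f: "control_function n f \<H>" "dilation f"
    using ANdim_attained by blast
  obtain K0 where K0: "K0 > 0" "\<And>r. r > 0 \<Longrightarrow> f r \<le> K0 * r" using f(2) unfolding dilation_def by blast
  \<comment> \<open>The collars need two colours, that is, dimension at least 1.\<close>
  define N where "N = max n 1"
  have N: "2 \<le> N + 1" "n + 1 \<le> N + 1" by (auto simp: N_def)
  \<comment> \<open>\<open>K\<close> depends only on \<open>k\<close>, \<open>N\<close> and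
    \<open>K0\<close>, so the same dilation serves every member of \<open>\<G>\<close>.\<close>
  obtain K where K: "K > 0" "\<And>dl D V (B :: 'a set). two_closeness D dl \<Longrightarrow>
      td D (controlled D dl (N + 1) K0) (\<lambda>S. finite S \<and> card S < Suc k) V B \<Longrightarrow> controlled D dl (N + 1) K V"
    using td_controlled[OF N(1) K0(1), of "Suc k", where ?'a = 'a] by blast
  have "\<exists>c. colouring (N + 1) r (K * r) G c" if G: "G \<in> \<G>" and r: "r > 0" for G r
  proof -
    have gG: "graph G" using assms(2) G by (simp add: weighted_graph_def)
    obtain T B where con: "construction k \<H> G T B" using assms(3) G unfolding constructable_def by blast
    show ?thesis
      by (rule colouring_of_controlled[OF gG construction_controlled[OF gG con f(1) K0(2,1) N(2) K(2)] r])
  qed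
  then have "control_function N (\<lambda>r. K * r) \<G>" using K(1) by (simp add: control_function_def)
  moreover have "dilation (\<lambda>r. K * r)" using K(1) by (auto simp: dilation_def)
  ultimately have "ANdim \<G> \<le> enat N" using ANdim_le by blast
  also have "enat N = max (ANdim \<H>) 1" by (simp add: n N_def one_enat_def max_def)
  finally show ?thesis .
qed simp

end
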